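(* Let $f:\mathbb{R}^N\to\mathbb{R}$ be convex and differentiable, let $\psi(x)=\sum_{i=1}^n\psi^i(x^i)$ with each $\psi^i:\mathbb{R}^{N_i}\to\mathbb{R}\cup\{+\infty\}$ convex and closed, and let $F=f+\psi$. Let $\hat S$ be an arbitrary proper sampling with probability vector $p=(p_1,\dots,p_n)$ and let $v\in\mathbb{R}^n_{++}$ be such that $(f,\hat S)\sim ESO(v)$. Choose $\theta_0\in(0,\min_ip_i]$ and define $\{\theta_k\}_{k\ge0}$ by $$\theta_{k+1}=\frac{\sqrt{\theta_k^4+4\theta_k^2}-\theta_k^2}{2}.$$ For $y\in\mathbb{R}^N$ let $$C=(1-\theta_0)\big(F(x_0)-F(y)\big)+\frac{\theta_0^2}{2}\|x_0-y\|^2_{v\circ p^{-2}}.$$ Then for any $y\in\mathbb{R}^N$ such that $C\ge0$, the iterates $\{x_k\}_{k\ge1}$ of the ALPHA algorithm satisfy, for all $k\ge1$, $$\mathbf{E}[F(x_k)]-F(y)\le\frac{4C}{((k-1)\theta_0+2)^2}.$$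
   Context: Block structure: $\mathbb{R}^N=\mathbb{R}^{N_1}\times\dots\times\mathbb{R}^{N_n}$, $[n]=\{1,\dots,n\}$; $x^i\in\mathbb{R}^{N_i}$ is the $i$th block of $x\in\mathbb{R}^N$, and $U_i$ is the $N\times N_i$ column submatrix of the identity with $x^i=U_i^\top x$. For $S\subseteq[n]$, $h_{[S]}=\sum_{i\in S}U_ih^i$. $\nabla_i f(x)=U_i^\top\nabla f(x)$. $\langle\cdot,\cdot\rangle$ is the standard inner product. For each $i$, $B_i$ is a fixed (symmetric) positive definite $N_i\times N_i$ matrix and $\|x^i\|_i^2=\langle B_ix^i,x^i\rangle$. For $w\in\mathbb{R}^n_{++}$ (vectors with positive entries): $\langle x,y\rangle_w=\sum_i w_i\langle x^i,y^i\rangle$ and $\|x\|_w^2=\sum_i w_i\|x^i\|_i^2$. For vectors in $\mathbb{R}^n$: $\circ$ is the elementwise product, and $p^{-1},p^{-2}$ are elementwise powers. For $u\in\mathbb{R}^n$, $x\in\mathbb{R}^N$: $u\cdot x=\sum_i u_iU_ix^i$. $\mathrm{dom}\,\psi=\{x:\psi(x)<+\infty\}$. Sampling: a sampling $\hat S$ is a random subset of $[n]$; $p_i=\mathrm{Prob}(i\in\hat S)$; it is proper if $p_i>0$ for all $i$. ESO: $(f,\hat S)\sim ESO(v)$ means that for all $x,h\in\mathbb{R}^N$, $\mathbf{E}[f(x+h_{[\hat S]})]\le f(x)+\langle\nabla f(x),h\rangle_p+\frac12\|h\|^2_{v\circ p}$. ALPHA algorithm (parameters $\hat S,v,\{\theta_k\}_{k\ge0}$):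 choose $x_0\in\mathrm{dom}\,\psi$, set $z_0=x_0$. For $k\ge0$: $y_k=(1-\theta_k)x_k+\theta_kz_k$; draw a random set $S_k$ with the distribution of $\hat S$, independently of the past; set $z_{k+1}^i=\arg\min_{z\in\mathbb{R}^{N_i}}\{\langle\nabla_if(y_k),z\rangle+\frac{\theta_kv_i}{2p_i}\|z-z_k^i\|_i^2+\psi^i(z)\}$ for $i\in S_k$ and $z_{k+1}^i=z_k^i$ for $i\notin S_k$; set $x_{k+1}=y_k+\theta_kp^{-1}\cdot(z_{k+1}-z_k)$. *)

theory Defs
  imports "HOL-Probability.Probability"
begin

(* A block structure on R^N is a map blk from the coordinates to the block labels: block i
   consists of the coordinates j with blk j = i, and N_i is their number.  R^{N_i} is
   represented as the coordinate subspace U_i R^{N_i} of R^N, and the block x^i as the vector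
   U_i x^i of that subspace.  The embedding U_i is an isometry, so inner products of blocks are
   the ones of R^N. *)

definition block_space :: "('m::finite \<Rightarrow> 'n) \<Rightarrow> 'n \<Rightarrow> (real ^ 'm) set" where
  "block_space blk i = {z. \<forall>j. blk j \<noteq> i \<longrightarrow> z $ j = 0}"

definition block :: "('m::finite \<Rightarrow> 'n) \<Rightarrow> 'n \<Rightarrow> real ^ 'm \<Rightarrow> real ^ 'm" where
  "block blk i x = (\<chi> j. if blk j = i then x $ j else 0)"

definition restrict_blocks :: "('m::finite \<Rightarrow> 'n::finite) \<Rightarrow> 'n set \<Rightarrow> real ^ 'm \<Rightarrow> real ^ 'm" where
  "restrict_blocks blk A h = (\<Sum>i\<in>A. block blk i h)"

definition scale_blocks :: "('m::finite \<Rightarrow> 'n::finite) \<Rightarrow> real ^ 'n \<Rightarrow> real ^ 'm \<Rightarrow> real ^ 'm" where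
  "scale_blocks blk u x = (\<Sum>i\<in>UNIV. (u $ i) *\<^sub>R block blk i x)"

(* B_i is the submatrix of B with rows and columns in block i; the other entries of B are
   irrelevant. *)
definition block_pos_def :: "('m::finite \<Rightarrow> 'n) \<Rightarrow> 'n \<Rightarrow> real ^ 'm ^ 'm \<Rightarrow> bool" where
  "block_pos_def blk i B \<longleftrightarrow>
     (\<forall>j k. blk j = i \<and> blk k = i \<longrightarrow> B $ j $ k = B $ k $ j) \<and>
     (\<forall>z\<in>block_space blk i. z \<noteq> 0 \<longrightarrow> (B *v z) \<bullet> z > 0)"

(* The squared norm of a block z, to be used for z in block_space blk i only. *)
definition block_norm_sq :: "('n \<Rightarrow> real ^ 'm ^ 'm) \<Rightarrow> 'n \<Rightarrow> real ^ 'm::finite \<Rightarrow> real" where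
  "block_norm_sq B i z = (B i *v z) \<bullet> z"

definition winner :: "('m::finite \<Rightarrow> 'n::finite) \<Rightarrow> real ^ 'n \<Rightarrow> real ^ 'm \<Rightarrow> real ^ 'm \<Rightarrow> real" where
  "winner blk w x y = (\<Sum>i\<in>UNIV. w $ i * (block blk i x \<bullet> block blk i y))"

definition wnorm_sq ::
  "('m::finite \<Rightarrow> 'n::finite) \<Rightarrow> ('n \<Rightarrow> real ^ 'm ^ 'm) \<Rightarrow> real ^ 'n \<Rightarrow> real ^ 'm \<Rightarrow> real" where
  "wnorm_sq blk B w x = (\<Sum>i\<in>UNIV. w $ i * block_norm_sq B i (block blk i x))"

definition grad :: "('a::real_inner \<Rightarrow> real) \<Rightarrow> 'a \<Rightarrow> 'a" where
  "grad f x = (THE g. GDERIV f x :> g)"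

definition epigraph_on :: "'a set \<Rightarrow> ('a \<Rightarrow> ereal) \<Rightarrow> ('a \<times> real) set" where
  "epigraph_on E g = {(z, t). z \<in> E \<and> g z \<le> ereal t}"

definition closed_convex_on :: "'a::real_normed_vector set \<Rightarrow> ('a \<Rightarrow> ereal) \<Rightarrow> bool" where
  "closed_convex_on E g \<longleftrightarrow>
     (\<forall>z\<in>E. g z \<noteq> - \<infinity>) \<and> convex (epigraph_on E g) \<and> closed (epigraph_on E g)"

definition block_sum ::
  "('m::finite \<Rightarrow> 'n::finite) \<Rightarrow> ('n \<Rightarrow> real ^ 'm \<Rightarrow> ereal) \<Rightarrow> real ^ 'm \<Rightarrow> ereal" where
  "block_sum blk psi x = (\<Sum>i\<in>UNIV. psi i (block blk i x))"

definition edom :: "('a \<Rightarrow> ereal) \<Rightarrow> 'a set" where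
  "edom g = {x. g x < \<infinity>}"

(* The distribution of a random subset of the finite set of block labels is a pmf on sets. *)
definition sampling_prob :: "'n::finite set pmf \<Rightarrow> real ^ 'n" where
  "sampling_prob Shat = (\<chi> i. measure_pmf.prob Shat {A. i \<in> A})"

definition proper_sampling :: "'n::finite set pmf \<Rightarrow> bool" where
  "proper_sampling Shat \<longleftrightarrow> (\<forall>i. sampling_prob Shat $ i > 0)"

definition ESO ::
  "('m::finite \<Rightarrow> 'n::finite) \<Rightarrow> ('n \<Rightarrow> real ^ 'm ^ 'm) \<Rightarrow> (real ^ 'm \<Rightarrow> real) \<Rightarrow> 'n set pmf \<Rightarrow>
   real ^ 'n \<Rightarrow> bool" where
  "ESO blk B f Shat v \<longleftrightarrow>
     (\<forall>x h. measure_pmf.expectation Shat (\<lambda>A. f (x + restrict_blocks blk A h))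
        \<le> f x + winner blk (sampling_prob Shat) (grad f x) h
            + wnorm_sq blk B (\<chi> i. v $ i * sampling_prob Shat $ i) h / 2)"

(* The argument t is the value of theta_k, and zk is the current iterate z_k. *)
definition alpha_block_argmin ::
  "('m::finite \<Rightarrow> 'n::finite) \<Rightarrow> ('n \<Rightarrow> real ^ 'm ^ 'm) \<Rightarrow> (real ^ 'm \<Rightarrow> real) \<Rightarrow>
   ('n \<Rightarrow> real ^ 'm \<Rightarrow> ereal) \<Rightarrow> real ^ 'n \<Rightarrow> real ^ 'n \<Rightarrow> real \<Rightarrow> real ^ 'm \<Rightarrow> real ^ 'm \<Rightarrow> 'n \<Rightarrow>
   real ^ 'm" where
  "alpha_block_argmin blk B f psi p v t y zk i =
     arg_min
       (\<lambda>z. ereal (block blk i (grad f y) \<bullet> z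
                 + t * v $ i / (2 * p $ i) * block_norm_sq B i (z - block blk i zk))
            + psi i z)
       (\<lambda>z. z \<in> block_space blk i)"

definition alpha_z_step ::
  "('m::finite \<Rightarrow> 'n::finite) \<Rightarrow> ('n \<Rightarrow> real ^ 'm ^ 'm) \<Rightarrow> (real ^ 'm \<Rightarrow> real) \<Rightarrow>
   ('n \<Rightarrow> real ^ 'm \<Rightarrow> ereal) \<Rightarrow> real ^ 'n \<Rightarrow> real ^ 'n \<Rightarrow> real \<Rightarrow> 'n set \<Rightarrow> real ^ 'm \<Rightarrow> real ^ 'm \<Rightarrow>
   real ^ 'm" where
  "alpha_z_step blk B f psi p v t A y zk =
     (\<Sum>i\<in>UNIV. if i \<in> A then alpha_block_argmin blk B f psi p v t y zk i else block blk i zk)"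

(* The pair (x_k, z_k) for a given realisation S_0, S_1, ... of the random sets. *)
primrec alpha_xz ::
  "('m::finite \<Rightarrow> 'n::finite) \<Rightarrow> ('n \<Rightarrow> real ^ 'm ^ 'm) \<Rightarrow> (real ^ 'm \<Rightarrow> real) \<Rightarrow>
   ('n \<Rightarrow> real ^ 'm \<Rightarrow> ereal) \<Rightarrow> real ^ 'n \<Rightarrow> real ^ 'n \<Rightarrow> (nat \<Rightarrow> real) \<Rightarrow> real ^ 'm \<Rightarrow>
   (nat \<Rightarrow> 'n set) \<Rightarrow> nat \<Rightarrow> (real ^ 'm) \<times> (real ^ 'm)" where
  "alpha_xz blk B f psi p v theta x0 S 0 = (x0, x0)"
| "alpha_xz blk B f psi p v theta x0 S (Suc k) =
     (let (x, z) = alpha_xz blk B f psi p v theta x0 S k;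
          y = (1 - theta k) *\<^sub>R x + theta k *\<^sub>R z;
          z' = alpha_z_step blk B f psi p v (theta k) (S k) y z
      in (y + theta k *\<^sub>R scale_blocks blk (\<chi> i. inverse (p $ i)) (z' - z), z'))"

definition alpha_x ::
  "('m::finite \<Rightarrow> 'n::finite) \<Rightarrow> ('n \<Rightarrow> real ^ 'm ^ 'm) \<Rightarrow> (real ^ 'm \<Rightarrow> real) \<Rightarrow>
   ('n \<Rightarrow> real ^ 'm \<Rightarrow> ereal) \<Rightarrow> real ^ 'n \<Rightarrow> real ^ 'n \<Rightarrow> (nat \<Rightarrow> real) \<Rightarrow> real ^ 'm \<Rightarrow>
   (nat \<Rightarrow> 'n set) \<Rightarrow> nat \<Rightarrow> real ^ 'm" where
  "alpha_x blk B f psi p v theta x0 S k = fst (alpha_xz blk B f psi p v theta x0 S k)"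

(* Expectation of the positive part minus expectation of the negative part; e2ennreal sends
   negative values to 0.  The undefined case \<infinity> - \<infinity> has the value \<infinity> in ereal, so
   an upper bound below \<infinity> on it always asserts that the expectation is well defined. *)
definition ereal_expectation :: "'w measure \<Rightarrow> ('w \<Rightarrow> ereal) \<Rightarrow> ereal" where
  "ereal_expectation M X =
     enn2ereal (\<integral>\<^sup>+ w. e2ennreal (X w) \<partial>M) - enn2ereal (\<integral>\<^sup>+ w. e2ennreal (- X w) \<partial>M)"

end

theory Submission
  imports Defs
begin

text \<open>
  Everything rests on a potential that decreases in conditional expectation. Write
  \<open>\<theta>\<^sub>k\<close> for the step parameters, \<open>u\<close> for the comparison point and \<open>W\<close> for the squared norm
  with weights \<open>v\<^sub>i / p\<^sub>i\<^sup>2\<close>. The natural candidate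
  \<open>(1 - \<theta>\<^sub>k) / \<theta>\<^sub>k\<^sup>2 * (F(x\<^sub>k) - F(u)) + W(z\<^sub>k - u) / 2\<close>
  fails, because the ESO inequality controls \<open>f\<close> at the sampled point but says nothing about
  \<open>\<psi>\<close> there. The remedy is to replace \<open>\<psi>(x\<^sub>k)\<close> by an upper bound that is affine in the values
  \<open>\<psi>\<^sup>i(z\<^sub>j\<^sup>i)\<close>. Block \<open>i\<close> of \<open>x\<^sub>k\<close> is an average of \<open>z\<^sub>0\<^sup>i, \<dots>, z\<^sub>k\<^sup>i\<close>; the coefficients of
  this average (\<open>lagged\<close> below) are nonnegative because \<open>\<theta>\<^sub>k\<close> decreases from
  \<open>\<theta>\<^sub>0 \<le> p\<^sub>i\<close>. The same average of the numbers \<open>\<psi>\<^sup>i(z\<^sub>j\<^sup>i)\<close> therefore dominates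
  \<open>\<psi>\<^sup>i(x\<^sub>k\<^sup>i)\<close> by convexity (\<open>psi_le_psi_hat\<close>), and its conditional expectation after one more
  iteration is \<open>(1 - \<theta>\<^sub>k)\<close> times its old value plus \<open>\<theta>\<^sub>k\<close> times the value of \<open>\<psi>\<^sup>i\<close> at the
  block minimizer: the factor \<open>1 / p\<^sub>i\<close> in the update cancels the sampling probability.

  One iteration (\<open>expected_one_step\<close>) then combines four facts. The ESO inequality, applied to the step
  that would be taken if all blocks were updated, bounds the expected value of \<open>f\<close>. The three-point
  inequality of the proximal subproblem (\<open>prox_three_point\<close>), a consequence of the strong convexity of its
  quadratic term, compares the block minimizers with \<open>u\<close>. Convexity of \<open>f\<close> turns the linear terms
  at \<open>y\<^sub>k\<close> into \<open>(1 - \<theta>\<^sub>k) f(x\<^sub>k) + \<theta>\<^sub>k f(u)\<close>. Finally, sampling block \<open>i\<close> with probability \<open>p\<^sub>i\<close>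
  changes the weight \<open>v\<^sub>i / p\<^sub>i\<close> of the distances in the three-point inequality into the weight
  \<open>v\<^sub>i / p\<^sub>i\<^sup>2\<close> of \<open>W\<close>. The recursion for \<open>\<theta>\<close> says exactly that
  \<open>(1 - \<theta>\<^sub>k\<^sub>+\<^sub>1) / \<theta>\<^sub>k\<^sub>+\<^sub>1\<^sup>2 = 1 / \<theta>\<^sub>k\<^sup>2\<close>, so the potential telescopes; its initial value is
  \<open>C / \<theta>\<^sub>0\<^sup>2\<close>, and \<open>1 / \<theta>\<^sub>k\<close> grows by at least \<open>1 / 2\<close> per step, which gives the rate.

  The block minimizers exist because a closed convex function has an affine minorant, so that
  adding a positive definite quadratic makes it coercive. There are finitely many possible histories
  of the first \<open>k\<close> samples, so all expectations are those of bounded random variables.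
\<close>

section \<open>Convex functions and proximal minimization\<close>

lemma GDERIV_grad:
  fixes f :: "'a::euclidean_space \<Rightarrow> real"
  assumes "f differentiable (at x)"
  shows "GDERIV f x :> grad f x"
proof -
  obtain f' where f': "(f has_derivative f') (at x)"
    using assms by (auto simp: differentiable_def)
  have "linear f'"
    using f' has_derivative_linear by blast
  then have "f' = (\<lambda>h. h \<bullet> adjoint f' 1)"
    by (auto simp: fun_eq_iff adjoint_works)
  then have ex: "GDERIV f x :> adjoint f' 1"
    using f' by (simp add: gderiv_def)
  have "g = adjoint f' 1" if "GDERIV f x :> g" for g
  proof -
    have "(\<lambda>h. h \<bullet> g) = (\<lambda>h. h \<bullet> adjoint f' 1)"
      using that ex has_derivative_unique unfolding gderiv_def by blast
    then have "\<forall>h. h \<bullet> g = h \<bullet> adjoint f' 1"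
      by meson
    then show ?thesis
      by (simp only: vector_eq_ldot)
  qed
  with ex show ?thesis
    unfolding grad_def by (metis theI)
qed

lemma convex_above_gradient_plane:
  fixes f :: "'a::euclidean_space \<Rightarrow> real"
  assumes "convex_on UNIV f" and "f differentiable (at x)"
  shows "f x + grad f x \<bullet> (y - x) \<le> f y"
proof -
  define \<phi> where "\<phi> s = f (x + s *\<^sub>R (y - x))" for s :: real
  have "convex_on UNIV \<phi>"
  proof (rule convex_onI)
    fix t a b :: real
    assume "0 < t" "t < 1"
    have "x + ((1 - t) *\<^sub>R a + t *\<^sub>R b) *\<^sub>R (y - x)
        = (1 - t) *\<^sub>R (x + a *\<^sub>R (y - x)) + t *\<^sub>R (x + b *\<^sub>R (y - x))"
      by (simp add: algebra_simps)
    then show "\<phi> ((1 - t) *\<^sub>R a + t *\<^sub>R b) \<le> (1 - t) * \<phi> a + t * \<phi> b"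
      unfolding \<phi>_def using convex_onD[OF assms(1), of t] \<open>0 < t\<close> \<open>t < 1\<close> by simp
  qed simp
  moreover have "(\<phi> has_field_derivative grad f x \<bullet> (y - x)) (at 0)"
  proof -
    have "(f has_derivative (\<lambda>h. h \<bullet> grad f x)) (at (x + 0 *\<^sub>R (y - x)))"
      using GDERIV_grad[OF assms(2)] by (simp add: gderiv_def)
    moreover have "((\<lambda>s. x + s *\<^sub>R (y - x)) has_derivative (\<lambda>s. s *\<^sub>R (y - x))) (at 0)"
      by (auto intro!: derivative_eq_intros)
    ultimately have "(f \<circ> (\<lambda>s. x + s *\<^sub>R (y - x)) has_derivative
        (\<lambda>h. h \<bullet> grad f x) \<circ> (\<lambda>s. s *\<^sub>R (y - x))) (at 0)"
      by (intro diff_chain_at) auto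
    then show ?thesis
      unfolding has_field_derivative_def \<phi>_def
      by (simp add: o_def inner_commute mult_commute_abs)
  qed
  ultimately have "\<phi> 1 - \<phi> 0 \<ge> (grad f x \<bullet> (y - x)) * (1 - 0)"
    by (intro convex_on_imp_above_tangent[where A = UNIV]) auto
  then show ?thesis
    by (simp add: \<phi>_def)
qed

text \<open>
  The point \<open>(z0, g z0 - 1)\<close> lies strictly below the closed convex epigraph. A hyperplane that
  separates the two cannot be vertical, because \<open>(z0, g z0)\<close> is in the epigraph, and is thus the graph
  of an affine function.
\<close>

lemma closed_convex_on_affine_minorant:
  fixes g :: "'a::euclidean_space \<Rightarrow> ereal"
  assumes g: "closed_convex_on E g" and z0: "z0 \<in> E" "g z0 < \<infinity>"
  obtains a b where "\<And>z. z \<in> E \<Longrightarrow> ereal (b + a \<bullet> z) \<le> g z"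
proof -
  let ?K = "epigraph_on E g"
  obtain r where r: "g z0 = ereal r"
    using g z0 by (cases "g z0") (auto simp: closed_convex_on_def)
  have "(z0, r - 1) \<notin> ?K" and r_in: "(z0, r) \<in> ?K"
    using z0 r by (auto simp: epigraph_on_def)
  then obtain a c where ac: "a \<bullet> (z0, r - 1) < c" "\<forall>x\<in>?K. a \<bullet> x > c"
    using separating_hyperplane_closed_point[of ?K] g unfolding closed_convex_on_def by blast
  obtain a1 a2 where a: "a = (a1, a2)"
    by force
  have a2: "a2 > 0"
    using ac r_in by (force simp: a algebra_simps)
  show thesis
  proof (rule that[of "c / a2" "- a1 /\<^sub>R a2"])
    fix z assume z: "z \<in> E"
    show "ereal (c / a2 + (- a1 /\<^sub>R a2) \<bullet> z) \<le> g z"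
    proof (cases "g z")
      case (real t)
      then have "(z, t) \<in> ?K"
        using z by (simp add: epigraph_on_def)
      then have "a1 \<bullet> z + a2 * t > c"
        using ac(2) a by auto
      then show ?thesis
        using real a2 by (simp add: field_simps)
    qed (use g z in \<open>auto simp: closed_convex_on_def\<close>)
  qed
qed

text \<open>
  The affine minorant of \<open>g\<close> cannot outweigh the quadratic growth of \<open>q\<close>, so sublevel sets of \<open>q + g\<close>
  are bounded. Since \<open>g\<close> is only known through its closed epigraph, the minimization takes place there:
  the continuous function \<open>q z + t\<close> of \<open>(z, t)\<close> attains its minimum on a compact part of the epigraph.
\<close>

lemma closed_convex_on_plus_quadratic_attains_min:
  fixes g :: "'a::euclidean_space \<Rightarrow> ereal"
  assumes g: "closed_convex_on E g" and z0: "z0 \<in> E" "g z0 < \<infinity>"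
    and q_cont: "continuous_on UNIV q" and lam: "lam > 0"
    and q_ge: "\<And>z. z \<in> E \<Longrightarrow> lam * (norm (z - w))\<^sup>2 + l \<bullet> z \<le> q z"
  obtains z where "is_arg_min (\<lambda>z. ereal (q z) + g z) (\<lambda>z. z \<in> E) z"
proof -
  obtain a b where ab: "\<And>z. z \<in> E \<Longrightarrow> ereal (b + a \<bullet> z) \<le> g z"
    using closed_convex_on_affine_minorant[OF g z0] by blast
  obtain r where r: "g z0 = ereal r"
    using g z0 by (cases "g z0") (auto simp: closed_convex_on_def)
  define c0 where "c0 = q z0 + r"
  define K where "K = epigraph_on E g \<inter> {x. q (fst x) + snd x \<le> c0}"
  define e where "e = l + a"
  define c where "c = c0 - b - e \<bullet> w"
  \<comment> \<open>With \<open>r\<close> the distance from \<open>w\<close>, membership in \<open>K\<close> gives \<open>lam * r\<^sup>2 - norm e * r \<le> c\<close>, which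
    fails beyond this radius.\<close>
  define R where "R = 1 + (norm e + \<bar>c\<bar>) / lam"
  have K_bound: "norm (z - w) \<le> R \<and> \<bar>t\<bar> \<le> \<bar>b\<bar> + \<bar>c0\<bar> + (norm a + norm l) * (norm w + R)"
    if "(z, t) \<in> K" for z t
  proof -
    have zE: "z \<in> E" and gz: "g z \<le> ereal t" and qt: "q z + t \<le> c0"
      using that by (auto simp: K_def epigraph_on_def)
    have "ereal (b + a \<bullet> z) \<le> ereal t"
      using ab[OF zE] gz by (rule order_trans)
    then have t: "b + a \<bullet> z \<le> t"
      by simp
    note qz = q_ge[OF zE]
    have "lam * (norm (z - w))\<^sup>2 + e \<bullet> (z - w) \<le> c"
      using qz t qt by (simp add: c_def e_def algebra_simps)
    moreover have "\<bar>e \<bullet> (z - w)\<bar> \<le> norm e * norm (z - w)"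
      by (rule Cauchy_Schwarz_ineq2)
    ultimately have le: "norm (z - w) * (lam * norm (z - w) - norm e) \<le> c"
      by (simp add: algebra_simps power2_eq_square)
    have R: "norm (z - w) \<le> R"
    proof (rule ccontr)
      assume "\<not> ?thesis"
      then have gt: "norm (z - w) > R"
        by simp
      have R1: "R \<ge> 1"
        using lam by (simp add: R_def)
      have "lam * R < lam * norm (z - w)"
        using gt lam by simp
      moreover have "lam * R = lam + norm e + \<bar>c\<bar>"
        using lam by (simp add: R_def field_simps)
      ultimately have "lam * norm (z - w) - norm e > \<bar>c\<bar>"
        using lam by linarith
      then have "1 * \<bar>c\<bar> < norm (z - w) * (lam * norm (z - w) - norm e)"
        using gt R1 by (intro mult_le_less_imp_less) auto
      then show False
        using le by linarith
    qed
    have nz: "norm z \<le> norm w + R"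
      using R norm_triangle_ineq[of "z - w" w] by simp
    have "\<bar>a \<bullet> z\<bar> \<le> norm a * norm z" "\<bar>l \<bullet> z\<bar> \<le> norm l * norm z"
      by (rule Cauchy_Schwarz_ineq2)+
    moreover have "norm a * norm z \<le> norm a * (norm w + R)" "norm l * norm z \<le> norm l * (norm w + R)"
      using nz by (simp_all add: mult_left_mono)
    moreover have "0 \<le> lam * (norm (z - w))\<^sup>2"
      using lam by simp
    moreover have "0 \<le> norm a * norm z" "0 \<le> norm l * norm z"
      by simp_all
    ultimately have "\<bar>t\<bar> \<le> \<bar>b\<bar> + \<bar>c0\<bar> + (norm a * (norm w + R) + norm l * (norm w + R))"
      using t qt qz by linarith
    with R show ?thesis
      by (simp add: distrib_right)
  qed
  have "K \<subseteq> cball w R \<times> cball 0 (\<bar>b\<bar> + \<bar>c0\<bar> + (norm a + norm l) * (norm w + R))"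
    using K_bound by (auto simp: dist_norm norm_minus_commute)
  then have "bounded K"
    by (rule bounded_subset[rotated]) (intro bounded_Times bounded_cball)
  have q_fst: "continuous_on UNIV (\<lambda>x :: 'a \<times> real. q (fst x) + snd x)"
    by (intro continuous_intros continuous_on_compose2[OF q_cont]) auto
  have "closed K"
    unfolding K_def
    by (intro closed_Int closed_Collect_le q_fst continuous_on_const)
      (use g in \<open>simp add: closed_convex_on_def\<close>)
  have z0K: "(z0, r) \<in> K"
    using z0 r by (simp add: K_def epigraph_on_def c0_def)
  have "compact K"
    using \<open>bounded K\<close> \<open>closed K\<close> by (simp add: compact_eq_bounded_closed)
  then obtain x where x: "x \<in> K" "\<And>x'. x' \<in> K \<Longrightarrow> q (fst x) + snd x \<le> q (fst x') + snd x'"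
    using continuous_attains_inf[of K "\<lambda>x. q (fst x) + snd x"] z0K
      continuous_on_subset[OF q_fst subset_UNIV]
    by blast
  obtain z t where zt: "x = (z, t)"
    by force
  have zE: "z \<in> E" and gz: "g z \<le> ereal t" and qz: "q z + t \<le> c0"
    using x(1) by (auto simp: zt K_def epigraph_on_def)
  have "ereal (q z) + g z \<le> ereal (q z') + g z'" if z': "z' \<in> E" for z'
  proof -
    have "ereal (q z) + g z \<le> ereal (q z + t)"
      using gz by (cases "g z") auto
    also have "\<dots> \<le> ereal (q z') + g z'"
    proof (cases "g z'")
      case (real t')
      show ?thesis
      proof (cases "(z', t') \<in> K")
        case True
        then show ?thesis
          using x(2)[of "(z', t')"] by (simp add: zt real)
      next
        case False
        then show ?thesis
          using z' real qz by (simp add: K_def epigraph_on_def)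
      qed
    qed (use g z' in \<open>auto simp: closed_convex_on_def\<close>)
    finally show ?thesis .
  qed
  then show thesis
    using that[of z] zE by (auto simp: is_arg_min_def not_less)
qed

text \<open>
  Moving from the minimizer \<open>z\<close> a fraction \<open>s\<close> of the way to \<open>u\<close> does not decrease the objective. By
  convexity of \<open>g\<close> and the parabola identity for \<open>N\<close> along the segment, the change is at most \<open>s\<close> times
  the difference of the objectives at \<open>u\<close> and \<open>z\<close>, less \<open>s * (1 - s) * kap * N (u - z)\<close>. Dividing by
  \<open>s\<close> and letting \<open>s\<close> tend to \<open>0\<close> yields the claim.
\<close>

lemma prox_three_point:
  fixes g :: "real ^ 'm \<Rightarrow> ereal" and Q :: "real ^ 'm ^ 'm"
  defines "N \<equiv> \<lambda>h. (Q *v h) \<bullet> h"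
  assumes g: "closed_convex_on E g"
    and min: "is_arg_min (\<lambda>z. ereal (l \<bullet> z + kap * N (z - w)) + g z) (\<lambda>z. z \<in> E) z"
    and u: "u \<in> E" "g u = ereal gu"
  obtains gz where "g z = ereal gz"
    "l \<bullet> z + kap * N (z - w) + gz + kap * N (u - z) \<le> l \<bullet> u + kap * N (u - w) + gu"
proof -
  have zE: "z \<in> E"
    using min by (simp add: is_arg_min_def)
  have le: "ereal (l \<bullet> z + kap * N (z - w)) + g z \<le> ereal (l \<bullet> z' + kap * N (z' - w)) + g z'"
    if "z' \<in> E" for z'
    using min that by (auto simp: is_arg_min_def not_less)
  obtain gz where gz: "g z = ereal gz"
    using le[OF u(1)] u(2) g zE by (cases "g z") (auto simp: closed_convex_on_def)
  let ?D = "l \<bullet> u + kap * N (u - w) + gu - (l \<bullet> z + kap * N (z - w) + gz)"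
  have step: "(1 - s) * (kap * N (u - z)) \<le> ?D" if s: "0 < s" "s < 1" for s
  proof -
    define zs where "zs = (1 - s) *\<^sub>R z + s *\<^sub>R u"
    have "(1 - s) *\<^sub>R (z, gz) + s *\<^sub>R (u, gu) \<in> epigraph_on E g"
      using g zE u gz s
      by (intro convexD) (auto simp: closed_convex_on_def epigraph_on_def)
    then have zs: "zs \<in> E" "g zs \<le> ereal ((1 - s) * gz + s * gu)"
      by (auto simp: epigraph_on_def zs_def)
    have "ereal (l \<bullet> z + kap * N (z - w)) + g z
        \<le> ereal (l \<bullet> zs + kap * N (zs - w)) + ereal ((1 - s) * gz + s * gu)"
      using le[OF zs(1)] zs(2) by (meson add_left_mono order_trans)
    then have 1: "l \<bullet> z + kap * N (z - w) + gz
        \<le> l \<bullet> zs + kap * N (zs - w) + ((1 - s) * gz + s * gu)"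
      by (simp add: gz)
    have N_zs: "N (zs - w) = (1 - s) * N (z - w) + s * N (u - w) - s * (1 - s) * N (u - z)"
    proof -
      have "zs - w = (1 - s) *\<^sub>R (z - w) + s *\<^sub>R (u - w)" "u - z = (u - w) - (z - w)"
        by (simp_all add: zs_def algebra_simps)
      then show ?thesis
        unfolding N_def
        by (simp only:) (simp add: matrix_vector_right_distrib matrix_vector_mult_diff_distrib
            matrix_vector_mult_scaleR inner_simps, simp add: algebra_simps)
    qed
    have l_zs: "l \<bullet> zs = (1 - s) * (l \<bullet> z) + s * (l \<bullet> u)"
      by (simp add: zs_def inner_simps)
    have "s * ((1 - s) * (kap * N (u - z))) \<le> s * ?D"
      using 1 unfolding N_zs l_zs by (simp add: algebra_simps)
    then show ?thesis
      using s by simp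
  qed
  have "((\<lambda>s. (1 - s) * (kap * N (u - z))) \<longlongrightarrow> (1 - 0) * (kap * N (u - z))) (at_right 0)"
    by (intro tendsto_intros)
  moreover have "\<forall>\<^sub>F s in at_right 0. (1 - s) * (kap * N (u - z)) \<le> ?D"
    unfolding eventually_at_right_field using step by (intro exI[of _ 1]) auto
  ultimately have "(1 - 0) * (kap * N (u - z)) \<le> ?D"
    by (intro tendsto_upperbound) auto
  then show thesis
    using gz by (intro that[of gz]) auto
qed

section \<open>Block structure and block norms\<close>

lemma blocks_of_block [simp]: "block blk i (block blk j x) = (if i = j then block blk i x else 0)"
  by (auto simp: block_def vec_eq_iff)

lemma block_in_block_space [simp]: "block blk i x \<in> block_space blk i"
  by (simp add: block_def block_space_def)

lemma block_ident: "z \<in> block_space blk i \<Longrightarrow> block blk i z = z"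
  by (auto simp: block_def block_space_def vec_eq_iff)

lemma block_other: "z \<in> block_space blk i \<Longrightarrow> j \<noteq> i \<Longrightarrow> block blk j z = 0"
  by (auto simp: block_def block_space_def vec_eq_iff)

lemma linear_block: "linear (block blk i)"
  by (rule linearI) (auto simp: block_def vec_eq_iff)

lemmas block_linear_simps =
  linear_add[OF linear_block] linear_diff[OF linear_block] linear_scale[OF linear_block]
  linear_sum[OF linear_block] linear_0[OF linear_block]

lemma sum_blocks: "(\<Sum>i\<in>UNIV. block blk i x) = x"
  for blk :: "'m::finite \<Rightarrow> 'n::finite"
  by (simp add: block_def vec_eq_iff)

lemma block_eqI: "x = y" if "\<And>i. block blk i x = block blk i y"
  for blk :: "'m::finite \<Rightarrow> 'n::finite"
  by (metis (no_types, lifting) sum.cong sum_blocks that)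

lemma block_sum_of_blocks:
  fixes blk :: "'m::finite \<Rightarrow> 'n::finite"
  assumes "\<And>i. a i \<in> block_space blk i"
  shows "block blk j (\<Sum>i\<in>UNIV. a i) = a j"
proof -
  have "block blk j (a i) = (if i = j then a j else 0)" for i
    using block_ident[OF assms[of i]] block_other[OF assms[of i], of j] by auto
  then have "block blk j (\<Sum>i\<in>UNIV. a i) = (\<Sum>i\<in>UNIV. if i = j then a j else 0)"
    by (simp add: block_linear_simps)
  then show ?thesis
    by simp
qed

lemma block_scale_blocks: "block blk i (scale_blocks blk u x) = (u $ i) *\<^sub>R block blk i x"
proof -
  have "block blk i (scale_blocks blk u x) = (\<Sum>j\<in>UNIV. if j = i then (u $ i) *\<^sub>R block blk i x else 0)"
    unfolding scale_blocks_def block_linear_simps by (intro sum.cong) auto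
  then show ?thesis
    by simp
qed

lemma block_restrict_blocks:
  "block blk i (restrict_blocks blk A h) = (if i \<in> A then block blk i h else 0)"
proof -
  have "block blk i (restrict_blocks blk A h) = (\<Sum>j\<in>A. if j = i then block blk i h else 0)"
    unfolding restrict_blocks_def block_linear_simps by (intro sum.cong) auto
  then show ?thesis
    by simp
qed

lemma inner_block_left: "block blk i x \<bullet> y = block blk i x \<bullet> block blk i y"
  by (auto simp: inner_vec_def block_def intro!: sum.cong)

lemma inner_eq_sum_blocks: "x \<bullet> y = (\<Sum>i\<in>UNIV. block blk i x \<bullet> block blk i y)"
  for blk :: "'m::finite \<Rightarrow> 'n::finite"
proof -
  have "x \<bullet> y = (\<Sum>i\<in>UNIV. block blk i x) \<bullet> y"
    by (simp add: sum_blocks)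
  then show ?thesis
    by (simp add: inner_sum_left inner_block_left[of blk _ x y])
qed

lemma block_norm_sq_scale: "block_norm_sq B i (c *\<^sub>R h) = c\<^sup>2 * block_norm_sq B i h"
  by (simp add: block_norm_sq_def matrix_vector_mult_scaleR power2_eq_square)

lemma block_norm_sq_minus_commute: "block_norm_sq B i (a - b) = block_norm_sq B i (b - a)"
  using block_norm_sq_scale[of B i "- 1" "a - b"] by simp

lemma block_norm_sq_nonneg:
  "block_pos_def blk i (B i) \<Longrightarrow> z \<in> block_space blk i \<Longrightarrow> block_norm_sq B i z \<ge> 0"
  by (cases "z = 0") (auto simp: block_pos_def_def block_norm_sq_def less_imp_le)

lemma subspace_block_space: "subspace (block_space blk i)"
  by (auto simp: subspace_def block_space_def)

text \<open>
  By homogeneity it suffices to bound the form below on the unit sphere of the block space, which is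
  compact.
\<close>

lemma block_norm_sq_lower_bound:
  assumes B: "block_pos_def blk i (B i)"
  obtains lam where "lam > 0" "\<And>z. z \<in> block_space blk i \<Longrightarrow> lam * (norm z)\<^sup>2 \<le> block_norm_sq B i z"
proof -
  let ?K = "sphere 0 1 \<inter> block_space blk i"
  have cont: "continuous_on ?K (block_norm_sq B i)"
    unfolding block_norm_sq_def
    by (intro continuous_intros linear_continuous_on matrix_vector_mul_linear
        linear_conv_bounded_linear[THEN iffD1])
  have "compact ?K"
    by (intro compact_Int_closed compact_sphere closed_subspace subspace_block_space)
  have "\<exists>lam>0. \<forall>z\<in>?K. lam \<le> block_norm_sq B i z"
  proof (cases "?K = {}")
    case False
    then obtain x where x: "x \<in> ?K" "\<forall>z\<in>?K. block_norm_sq B i x \<le> block_norm_sq B i z"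
      using continuous_attains_inf[OF \<open>compact ?K\<close> _ cont] by blast
    then have "block_norm_sq B i x > 0"
      using B by (auto simp: block_pos_def_def block_norm_sq_def)
    with x show ?thesis
      by blast
  qed (auto intro: exI[of _ 1])
  then obtain lam where lam: "lam > 0" "\<And>z. z \<in> ?K \<Longrightarrow> lam \<le> block_norm_sq B i z"
    by blast
  show thesis
  proof (rule that[OF lam(1)])
    fix z assume z: "z \<in> block_space blk i"
    show "lam * (norm z)\<^sup>2 \<le> block_norm_sq B i z"
    proof (cases "z = 0")
      case True
      then show ?thesis by (simp add: block_norm_sq_def)
    next
      case False
      then have "z /\<^sub>R norm z \<in> ?K"
        using z by (simp add: subspace_scale[OF subspace_block_space])
      from lam(2)[OF this] have "lam \<le> block_norm_sq B i z / (norm z)\<^sup>2"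
        by (simp add: block_norm_sq_scale power_inverse divide_inverse mult.commute)
      then show ?thesis
        using False by (simp add: field_simps)
    qed
  qed
qed

section \<open>Step parameters and lagged averages\<close>

text \<open>
  The new parameter is the positive root of \<open>t'\<^sup>2 + t\<^sup>2 * t' - t\<^sup>2 = 0\<close>, which is the second claim. Written as
  \<open>(t + t') * (t - t') = t\<^sup>2 * t'\<close>, with \<open>t + t' \<le> 2 * t\<close>, the same equation gives the growth of the
  reciprocals.
\<close>

lemma theta_step:
  fixes t t' :: real
  assumes t: "t > 0" and t': "t' = (sqrt (t ^ 4 + 4 * t ^ 2) - t ^ 2) / 2"
  shows "t' > 0" "t'\<^sup>2 = (1 - t') * t\<^sup>2" "t' \<le> t" "1 / t' \<ge> 1 / t + 1 / 2"
proof -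
  define r where "r = sqrt (t ^ 4 + 4 * t ^ 2)"
  have r: "2 * t' = r - t\<^sup>2"
    unfolding t' r_def by simp
  have "t\<^sup>2 < r"
    unfolding r_def using t by (intro real_less_rsqrt) simp
  then show pos: "t' > 0"
    using r by linarith
  have "(2 * t' + t\<^sup>2)\<^sup>2 = t ^ 4 + 4 * t ^ 2"
    unfolding r using t by (simp add: r_def)
  then show eq: "t'\<^sup>2 = (1 - t') * t\<^sup>2"
    by algebra
  have "(1 - t') * t\<^sup>2 \<le> 1 * t\<^sup>2"
    using pos by (intro mult_right_mono) auto
  then have "t'\<^sup>2 \<le> t\<^sup>2"
    unfolding eq by simp
  then show le: "t' \<le> t"
    by (rule power2_le_imp_le) (use t in simp)
  have "(t + t') * (t - t') = t * t * t'"
    using eq by algebra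
  moreover have "(t * t') * ((t + t') / 2) \<le> (t * t') * t"
    using pos t le by (intro mult_left_mono) auto
  ultimately have "(t + t') * (t * t' / 2) \<le> (t + t') * (t - t')"
    by (simp add: mult_ac)
  then have "t * t' / 2 \<le> t - t'"
    using pos t by simp
  then show "1 / t' \<ge> 1 / t + 1 / 2"
    using pos t by (simp add: field_simps)
qed

text \<open>
  The fourth claim makes the potential telescope; the last one is the source of the quadratic rate.
\<close>

lemma theta_recursion_bounds:
  fixes theta :: "nat \<Rightarrow> real"
  assumes "0 < theta 0" "theta 0 \<le> 1"
    and Suc: "\<And>j. theta (Suc j) = (sqrt (theta j ^ 4 + 4 * theta j ^ 2) - theta j ^ 2) / 2"
  shows "0 < theta k" and "theta k \<le> 1" and "theta (Suc k) \<le> theta k"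
    and "(1 - theta (Suc k)) / theta (Suc k) ^ 2 = 1 / theta k ^ 2"
    and "theta k / theta 0 \<le> 2 / (real k * theta 0 + 2)"
proof -
  have pos: "0 < theta k" for k
    using assms(1) by (induction k) (auto intro: theta_step(1)[OF _ Suc])
  note step = theta_step[OF pos Suc]
  show "0 < theta k"
    by (rule pos)
  show "theta (Suc k) \<le> theta k"
    by (rule step)
  show "theta k \<le> 1"
    using assms(2) step(3) by (induction k) (auto intro: order_trans)
  have "theta (Suc k) ^ 2 \<noteq> 0" "theta k ^ 2 \<noteq> 0"
    using pos[of k] pos[of "Suc k"] by simp_all
  then show "(1 - theta (Suc k)) / theta (Suc k) ^ 2 = 1 / theta k ^ 2"
    using step(2)[of k] by (simp add: frac_eq_eq)
  have "1 / theta 0 + real k / 2 \<le> 1 / theta k"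
  proof (induction k)
    case (Suc k)
    then show ?case
      using step(4)[of k] by (simp add: add_divide_distrib)
  qed simp
  then have "theta 0 * (1 / theta 0 + real k / 2) \<le> theta 0 * (1 / theta k)"
    using pos[of 0] by (intro mult_left_mono) auto
  moreover have "theta 0 * (1 / theta 0 + real k / 2) = (real k * theta 0 + 2) / 2"
    using pos[of 0] by (simp add: field_simps)
  ultimately have le: "(real k * theta 0 + 2) / 2 \<le> theta 0 / theta k"
    by simp
  have "0 < (real k * theta 0 + 2) / 2"
    using pos[of 0] by (simp add: add_nonneg_pos)
  from le_imp_inverse_le[OF le this] show "theta k / theta 0 \<le> 2 / (real k * theta 0 + 2)"
    by simp
qed

text \<open>
  In the ALPHA method, block \<open>i\<close> of the sequence \<open>x\<^sub>k\<close> arises from block \<open>i\<close> of the sequence \<open>z\<^sub>k\<close>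
  through this recursion with \<open>p = p\<^sub>i\<close>. Isolating it as an operator on arbitrary sequences allows the
  same weights to be applied to the vectors \<open>z\<^sub>k\<^sup>i\<close> and to the numbers \<open>\<psi>\<^sup>i(z\<^sub>k\<^sup>i)\<close>.
\<close>

primrec lagged :: "(nat \<Rightarrow> real) \<Rightarrow> real \<Rightarrow> (nat \<Rightarrow> 'a::real_vector) \<Rightarrow> nat \<Rightarrow> 'a" where
  "lagged theta p q 0 = q 0"
| "lagged theta p q (Suc k) =
     (1 - theta k) *\<^sub>R lagged theta p q k + theta k *\<^sub>R q k + (theta k / p) *\<^sub>R (q (Suc k) - q k)"

lemma lagged_Pair: "lagged theta p (\<lambda>k. (a k, b k)) k = (lagged theta p a k, lagged theta p b k)"
  by (induction k) simp_all

lemma lagged_cong: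
  "(\<And>j. j \<le> k \<Longrightarrow> q j = q' j) \<Longrightarrow> lagged theta p q k = lagged theta p q' k"
  by (induction k) simp_all

text \<open>
  Each term is a convex combination of \<open>q 0, \<dots>, q k\<close>, although the recursion itself has the possibly
  negative coefficient \<open>theta k - theta k / p\<close> at \<open>q k\<close>. The previous term already contains \<open>q k\<close> with
  weight \<open>c k\<close>, and this is just enough to compensate. The invariant thus separates the weight \<open>c k\<close>
  of the latest point from a convex combination \<open>e\<close> of the others.
\<close>

lemma lagged_in_convex:
  assumes "convex E" and q: "\<And>k. q k \<in> E"
    and theta: "\<And>k. 0 < theta k" "\<And>k. theta (Suc k) \<le> theta k" "theta 0 \<le> p" "p \<le> 1"
  shows "lagged theta p q k \<in> E"
proof -
  have theta_p: "theta k \<le> p" for k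
    using theta(2,3) by (induction k) (auto intro: order_trans)
  have p: "p > 0"
    using theta(1)[of 0] theta(3) by linarith
  define c where "c k = (case k of 0 \<Rightarrow> 1 | Suc j \<Rightarrow> theta j / p)" for k
  have c01: "0 \<le> c k" "c k \<le> 1" for k
    using theta_p theta(1) p by (auto simp: c_def less_imp_le split: nat.split)
  \<comment> \<open>The new coefficient of \<open>q k\<close>: it is nonnegative since \<open>theta k \<le> c k * p\<close> (the parameters
    decrease from \<open>theta 0 \<le> p\<close>) and \<open>1 - p \<le> 1 - theta k\<close>.\<close>
  have mid: "0 \<le> (1 - theta k) * c k + theta k - theta k / p" for k
  proof -
    have "theta k \<le> c k * p"
      using theta_p[of 0] theta_p theta(2) p by (auto simp: c_def split: nat.split)
    then have "(1 - p) * theta k \<le> (1 - theta k) * (c k * p)"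
      using theta_p[of k] theta(1)[of k] \<open>p \<le> 1\<close> by (intro mult_mono) auto
    then show ?thesis
      using p by (simp add: field_simps)
  qed
  have "\<exists>e\<in>E. lagged theta p q k = (1 - c k) *\<^sub>R e + c k *\<^sub>R q k"
  proof (induction k)
    case 0
    then show ?case
      using q by (auto simp: c_def intro!: bexI[of _ "q 0"])
  next
    case (Suc k)
    then obtain e where e: "e \<in> E" "lagged theta p q k = (1 - c k) *\<^sub>R e + c k *\<^sub>R q k"
      by blast
    define a where "a = (1 - theta k) * (1 - c k)"
    define b where "b = (1 - theta k) * c k + theta k - theta k / p"
    have "a \<ge> 0"
      using c01[of k] theta_p[of k] \<open>p \<le> 1\<close> by (auto simp: a_def)
    moreover have "b \<ge> 0"
      using mid[of k] by (simp add: b_def)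
    moreover have "a + b = 1 - c (Suc k)"
      by (simp add: a_def b_def c_def[of "Suc k"] algebra_simps)
    ultimately have ab: "a \<ge> 0" "b \<ge> 0" "a + b = 1 - c (Suc k)" .
    have eq: "lagged theta p q (Suc k) = a *\<^sub>R e + b *\<^sub>R q k + c (Suc k) *\<^sub>R q (Suc k)"
      by (simp add: e a_def b_def c_def algebra_simps)
    \<comment> \<open>If both old weights vanish, \<open>q (Suc k)\<close> carries everything and any point of \<open>E\<close> can serve as
      \<open>e\<close>.\<close>
    show ?case
    proof (cases "a + b = 0")
      case True
      then have "a = 0" "b = 0"
        using ab by auto
      then show ?thesis
        using e(1) ab(3) unfolding eq by (auto intro!: bexI[of _ e])
    next
      case False
      then have pos: "a + b > 0"
        using ab by auto
      let ?e = "(a / (a + b)) *\<^sub>R e + (b / (a + b)) *\<^sub>R q k"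
      have "?e \<in> E"
        using assms(1) e(1) q ab pos
        by (intro convexD) (auto simp flip: add_divide_distrib)
      moreover have "a *\<^sub>R e + b *\<^sub>R q k = (1 - c (Suc k)) *\<^sub>R ?e"
        using pos by (simp add: scaleR_add_right flip: ab(3))
      ultimately show ?thesis
        unfolding eq by (auto intro!: bexI[of _ ?e])
    qed
  qed
  then obtain e where "e \<in> E" "lagged theta p q k = (1 - c k) *\<^sub>R e + c k *\<^sub>R q k"
    by blast
  then show ?thesis
    using assms(1) q c01 by (auto intro!: convexD)
qed

section \<open>Expectations over finite histories of samples\<close>

lemma expectation_by_membership:
  fixes D :: "'n::finite set pmf" and a b :: real
  shows "measure_pmf.expectation D (\<lambda>A. if i \<in> A then a else b)
    = b + sampling_prob D $ i * (a - b)"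
proof -
  have "(\<lambda>A. if i \<in> A then a else b) = (\<lambda>A. b + indicat_real {A. i \<in> A} A * (a - b))"
    by (auto simp: fun_eq_iff indicator_def)
  then show ?thesis
    by (simp add: sampling_prob_def integrable_measure_pmf_finite)
qed

text \<open>
  The first \<open>k\<close> samples take finitely many values jointly, so a function of them is bounded, and it is
  measurable because the product of finitely many finite discrete spaces is discrete.
\<close>

lemma (in prob_space) integrable_finite_history:
  fixes S :: "nat \<Rightarrow> 'a \<Rightarrow> 'b::finite" and G :: "(nat \<Rightarrow> 'b) \<Rightarrow> real"
  assumes rv: "\<And>j. random_variable (count_space UNIV) (S j)"
    and dep: "\<And>s s'. (\<And>j. j < k \<Longrightarrow> s j = s' j) \<Longrightarrow> G s = G s'"
  shows "integrable M (\<lambda>w. G (\<lambda>j. S j w))"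
proof -
  let ?H = "\<lambda>w. \<lambda>j\<in>{..<k}. S j w"
  have "?H \<in> measurable M (PiM {..<k} (\<lambda>_. count_space UNIV))"
    by (intro measurable_restrict rv)
  then have H: "?H \<in> measurable M (count_space (PiE {..<k} (\<lambda>_. UNIV)))"
    by (simp add: count_space_PiM_finite)
  have GH: "G (\<lambda>j. S j w) = G (?H w)" for w
    by (rule dep) simp
  have "finite (PiE {..<k} (\<lambda>_. UNIV :: 'b set))"
    by (intro finite_PiE) auto
  then have "finite (G ` PiE {..<k} (\<lambda>_. UNIV))"
    by (rule finite_imageI)
  then obtain b where b: "\<And>g. g \<in> PiE {..<k} (\<lambda>_. UNIV) \<Longrightarrow> norm (G g) \<le> b"
    using finite_imp_bounded[of "G ` PiE {..<k} (\<lambda>_. UNIV)"] unfolding bounded_iff by blast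
  show ?thesis
    unfolding GH
  proof (rule integrable_const_bound[of _ b])
    show "AE w in M. norm (G (?H w)) \<le> b"
      using b by (intro AE_I2) auto
    show "(\<lambda>w. G (?H w)) \<in> borel_measurable M"
      using H by (rule measurable_compose) simp
  qed
qed

text \<open>
  The next sample may be averaged out first, with the earlier ones held fixed. Splitting according to
  the value \<open>A\<close> of that sample writes \<open>G\<close> as a finite sum of products of a function of the earlier
  samples and the indicator of \<open>S k = A\<close>, and expectations of such products factor.
\<close>

lemma (in prob_space) expectation_next_given_history:
  fixes S :: "nat \<Rightarrow> 'a \<Rightarrow> 'b::finite" and G :: "(nat \<Rightarrow> 'b) \<Rightarrow> real"
  assumes indep: "indep_vars (\<lambda>_. count_space UNIV) S UNIV"
    and distr: "distr M (count_space UNIV) (S k) = measure_pmf D"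
    and dep: "\<And>s s'. (\<And>j. j < Suc k \<Longrightarrow> s j = s' j) \<Longrightarrow> G s = G s'"
  shows "expectation (\<lambda>w. G (\<lambda>j. S j w))
    = expectation (\<lambda>w. measure_pmf.expectation D (\<lambda>A. G ((\<lambda>j. S j w)(k := A))))"
proof -
  let ?s = "\<lambda>w j. S j w"
  have rv: "random_variable (count_space UNIV) (S j)" for j
    using indep by (simp add: indep_vars_def)
  define I where "I A w = indicat_real {A} (S k w)" for A w
  have int_G: "integrable M (\<lambda>w. G ((?s w)(k := A)))" for A
    by (rule integrable_finite_history[OF rv, where k = k and G = "\<lambda>s. G (s(k := A))"])
      (auto intro: dep)
  have int_I: "integrable M (I A)" for A
    unfolding I_def
    by (rule integrable_finite_history[OF rv, where k = "Suc k" and G = "\<lambda>s. indicat_real {A} (s k)"])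
      simp
  have exp_I: "expectation (I A) = pmf D A" for A
  proof -
    have "expectation (I A) = (\<integral>x. indicat_real {A} x \<partial>distr M (count_space UNIV) (S k))"
      unfolding I_def by (subst integral_distr[OF rv]) auto
    then show ?thesis
      by (simp add: distr pmf.rep_eq)
  qed
  have ind: "indep_var borel (\<lambda>w. G ((?s w)(k := A))) borel (I A)" for A
  proof -
    have "indep_var borel ((\<lambda>h. G (h(k := A))) \<circ> (\<lambda>w. \<lambda>j\<in>{..<k}. S j w))
        borel ((\<lambda>h. indicat_real {A} (h k)) \<circ> (\<lambda>w. \<lambda>j\<in>{k}. S j w))"
      by (rule indep_var_compose[OF indep_var_restrict[OF indep]])
        (auto simp: count_space_PiM_finite)
    moreover have "(\<lambda>h. G (h(k := A))) \<circ> (\<lambda>w. \<lambda>j\<in>{..<k}. S j w) = (\<lambda>w. G ((?s w)(k := A)))"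
      unfolding o_def by (intro ext dep) auto
    moreover have "(\<lambda>h. indicat_real {A} (h k)) \<circ> (\<lambda>w. \<lambda>j\<in>{k}. S j w) = I A"
      by (simp add: o_def I_def fun_eq_iff)
    ultimately show ?thesis
      by simp
  qed
  have "expectation (\<lambda>w. G (?s w)) = expectation (\<lambda>w. \<Sum>A\<in>UNIV. G ((?s w)(k := A)) * I A w)"
  proof (intro Bochner_Integration.integral_cong refl)
    fix w
    have "(\<Sum>A\<in>UNIV. G ((?s w)(k := A)) * I A w) = (\<Sum>A\<in>UNIV. if A = S k w then G (?s w) else 0)"
      by (intro sum.cong) (auto simp: I_def indicator_def fun_upd_idem)
    then show "G (?s w) = (\<Sum>A\<in>UNIV. G ((?s w)(k := A)) * I A w)"
      by simp
  qed
  also have "\<dots> = (\<Sum>A\<in>UNIV. expectation (\<lambda>w. G ((?s w)(k := A)) * I A w))"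
    by (intro Bochner_Integration.integral_sum indep_var_integrable ind int_G int_I)
  also have "\<dots> = (\<Sum>A\<in>UNIV. expectation (\<lambda>w. G ((?s w)(k := A)) * pmf D A))"
    by (simp add: indep_var_lebesgue_integral[OF ind int_G int_I] exp_I)
  also have "\<dots> = expectation (\<lambda>w. \<Sum>A\<in>UNIV. G ((?s w)(k := A)) * pmf D A)"
    by (intro Bochner_Integration.integral_sum[symmetric] integrable_mult_left int_G)
  also have "\<dots> = expectation (\<lambda>w. measure_pmf.expectation D (\<lambda>A. G ((?s w)(k := A))))"
    by (simp add: integral_measure_pmf_real[of UNIV])
  finally show ?thesis .
qed

lemma ereal_expectation_real:
  assumes X: "integrable M X"
  shows "ereal_expectation M (\<lambda>w. ereal (X w)) = ereal (integral\<^sup>L M X)"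
proof -
  have fin: "(\<integral>\<^sup>+ w. ennreal (X w) \<partial>M) < \<infinity>" "(\<integral>\<^sup>+ w. ennreal (- X w) \<partial>M) < \<infinity>"
    using X by (auto simp: real_integrable_def top.not_eq_extremum)
  then obtain a b where ab: "(\<integral>\<^sup>+ w. ennreal (X w) \<partial>M) = ennreal a" "a \<ge> 0"
    "(\<integral>\<^sup>+ w. ennreal (- X w) \<partial>M) = ennreal b" "b \<ge> 0"
    by (metis ennreal_cases infinity_ennreal_def order_less_irrefl)
  then show ?thesis
    unfolding ereal_expectation_def real_lebesgue_integral_def[OF X]
    by (simp add: e2ennreal_ereal)
qed

section \<open>One iteration of the method\<close>

locale alpha_problem =
  fixes blk :: "'m::finite \<Rightarrow> 'n::finite"
    and B :: "'n \<Rightarrow> real ^ 'm ^ 'm"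
    and f :: "real ^ 'm \<Rightarrow> real"
    and psi :: "'n \<Rightarrow> real ^ 'm \<Rightarrow> ereal"
    and Shat :: "'n set pmf"
    and p v :: "real ^ 'n"
  assumes B: "\<And>i. block_pos_def blk i (B i)"
    and f_convex: "convex_on UNIV f"
    and f_diff: "\<And>x. f differentiable (at x)"
    and psi: "\<And>i. closed_convex_on (block_space blk i) (psi i)"
    and proper: "proper_sampling Shat"
    and p: "p = sampling_prob Shat"
    and v_pos: "\<And>i. v $ i > 0"
    and eso: "ESO blk B f Shat v"
begin

abbreviation dom_psi :: "(real ^ 'm) set" where
  "dom_psi \<equiv> edom (block_sum blk psi)"

definition psi_val :: "'n \<Rightarrow> real ^ 'm \<Rightarrow> real" where
  "psi_val i x = real_of_ereal (psi i (block blk i x))"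

abbreviation argmin :: "real \<Rightarrow> real ^ 'm \<Rightarrow> real ^ 'm \<Rightarrow> 'n \<Rightarrow> real ^ 'm" where
  "argmin \<equiv> alpha_block_argmin blk B f psi p v"

abbreviation z_step :: "real \<Rightarrow> 'n set \<Rightarrow> real ^ 'm \<Rightarrow> real ^ 'm \<Rightarrow> real ^ 'm" where
  "z_step \<equiv> alpha_z_step blk B f psi p v"

abbreviation dist_sq :: "real ^ 'm \<Rightarrow> real ^ 'm \<Rightarrow> real" where
  "dist_sq z u \<equiv> wnorm_sq blk B (\<chi> i. v $ i * inverse (p $ i) ^ 2) (z - u)"

lemma p_pos: "p $ i > 0"
  using proper by (simp add: p proper_sampling_def)

lemma p_le_1: "p $ i \<le> 1"
  by (simp add: p sampling_prob_def)

lemma psi_not_minf: "psi i (block blk i x) \<noteq> - \<infinity>"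
  using psi[of i] by (auto simp: closed_convex_on_def)

lemma dom_psi_iff: "x \<in> dom_psi \<longleftrightarrow> (\<forall>i. psi i (block blk i x) = ereal (psi_val i x))"
proof -
  have "x \<in> dom_psi \<longleftrightarrow> (\<forall>i. psi i (block blk i x) \<noteq> \<infinity>)"
    by (auto simp: edom_def block_sum_def less_top[symmetric] top_ereal_def sum_Pinfty)
  moreover have "psi i (block blk i x) \<noteq> \<infinity> \<longleftrightarrow> psi i (block blk i x) = ereal (psi_val i x)" for i
    using psi_not_minf[of i x] by (cases "psi i (block blk i x)") (auto simp: psi_val_def)
  ultimately show ?thesis
    by simp
qed

lemma block_sum_eq: "x \<in> dom_psi \<Longrightarrow> block_sum blk psi x = ereal (\<Sum>i\<in>UNIV. psi_val i x)"
  by (simp add: dom_psi_iff block_sum_def)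

lemma dist_sq_nonneg: "dist_sq z u \<ge> 0"
  unfolding wnorm_sq_def
  by (intro sum_nonneg mult_nonneg_nonneg block_norm_sq_nonneg[OF B])
    (use v_pos in \<open>auto simp: less_imp_le\<close>)

text \<open>
  The minimum defining a step is attained, so the choice operator in \<open>alpha_block_argmin\<close> returns a
  minimizer.
\<close>

lemma argmin_is_arg_min:
  assumes "t > 0" and z: "z \<in> dom_psi"
  shows "is_arg_min (\<lambda>\<zeta>. ereal (block blk i (grad f y) \<bullet> \<zeta>
             + t * v $ i / (2 * p $ i) * block_norm_sq B i (\<zeta> - block blk i z)) + psi i \<zeta>)
           (\<lambda>\<zeta>. \<zeta> \<in> block_space blk i) (argmin t y z i)"
proof -
  define kap where "kap = t * v $ i / (2 * p $ i)"
  have kap: "kap > 0"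
    using \<open>t > 0\<close> v_pos p_pos by (simp add: kap_def)
  obtain lam where lam: "lam > 0"
    "\<And>z. z \<in> block_space blk i \<Longrightarrow> lam * (norm z)\<^sup>2 \<le> block_norm_sq B i z"
    using block_norm_sq_lower_bound[of blk i B, OF B] by blast
  have "continuous_on UNIV (block_norm_sq B i)"
    unfolding block_norm_sq_def by (intro continuous_intros)
  then have "continuous_on UNIV (\<lambda>\<zeta>. block_norm_sq B i (\<zeta> - block blk i z))"
    by (rule continuous_on_compose2) (auto intro!: continuous_intros)
  then have cont: "continuous_on UNIV (\<lambda>\<zeta>. block blk i (grad f y) \<bullet> \<zeta> + kap * block_norm_sq B i (\<zeta> - block blk i z))"
    by (intro continuous_intros)
  have ge: "(kap * lam) * (norm (\<zeta> - block blk i z))\<^sup>2 + block blk i (grad f y) \<bullet> \<zeta>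
      \<le> block blk i (grad f y) \<bullet> \<zeta> + kap * block_norm_sq B i (\<zeta> - block blk i z)"
    if "\<zeta> \<in> block_space blk i" for \<zeta>
    using lam(2)[of "\<zeta> - block blk i z"] that kap
    by (simp add: subspace_diff[OF subspace_block_space])
  have "psi i (block blk i z) < \<infinity>"
    using z by (simp add: dom_psi_iff)
  then obtain \<zeta> where "is_arg_min (\<lambda>\<zeta>. ereal (block blk i (grad f y) \<bullet> \<zeta>
        + kap * block_norm_sq B i (\<zeta> - block blk i z)) + psi i \<zeta>)
      (\<lambda>\<zeta>. \<zeta> \<in> block_space blk i) \<zeta>"
    using closed_convex_on_plus_quadratic_attains_min[OF psi block_in_block_space _ cont
        mult_pos_pos[OF kap lam(1)] ge] by blast
  then show ?thesis
    unfolding alpha_block_argmin_def arg_min_def kap_def by (rule someI)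
qed

lemma argmin_in_block_space: "t > 0 \<Longrightarrow> z \<in> dom_psi \<Longrightarrow> argmin t y z i \<in> block_space blk i"
  using argmin_is_arg_min by (auto simp: is_arg_min_def)

lemma block_z_step:
  assumes "t > 0" "z \<in> dom_psi"
  shows "block blk i (z_step t A y z) = (if i \<in> A then argmin t y z i else block blk i z)"
  unfolding alpha_z_step_def
  by (subst block_sum_of_blocks) (auto simp: argmin_in_block_space[OF assms])

lemma argmin_three_point:
  fixes y z u i t
  defines "T \<equiv> argmin t y z i" and "kap \<equiv> t * v $ i / (2 * p $ i)"
  assumes "t > 0" and z: "z \<in> dom_psi" and u: "u \<in> dom_psi"
  shows "psi i T = ereal (psi_val i T)"
    and "block blk i (grad f y) \<bullet> T + kap * block_norm_sq B i (T - block blk i z)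
        + psi_val i T + kap * block_norm_sq B i (T - block blk i u)
      \<le> block blk i (grad f y) \<bullet> block blk i u
        + kap * block_norm_sq B i (block blk i z - block blk i u) + psi_val i u"
proof -
  note min = argmin_is_arg_min[OF \<open>t > 0\<close> z, of i y, folded T_def kap_def]
  have "block blk i T = T"
    using min by (simp add: is_arg_min_def block_ident)
  then have val: "psi_val i T = real_of_ereal (psi i T)"
    by (simp add: psi_val_def)
  have "psi i (block blk i u) = ereal (psi_val i u)"
    using u by (simp add: dom_psi_iff)
  from prox_three_point[OF psi min[unfolded block_norm_sq_def] block_in_block_space this]
  obtain gz where gz: "psi i T = ereal gz" and
    le: "block blk i (grad f y) \<bullet> T + kap * block_norm_sq B i (T - block blk i z) + gz
        + kap * block_norm_sq B i (block blk i u - T)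
      \<le> block blk i (grad f y) \<bullet> block blk i u
        + kap * block_norm_sq B i (block blk i u - block blk i z) + psi_val i u"
    unfolding block_norm_sq_def by metis
  have "gz = psi_val i T"
    by (simp add: val gz)
  then show "psi i T = ereal (psi_val i T)"
    using gz by simp
  show "block blk i (grad f y) \<bullet> T + kap * block_norm_sq B i (T - block blk i z)
        + psi_val i T + kap * block_norm_sq B i (T - block blk i u)
      \<le> block blk i (grad f y) \<bullet> block blk i u
        + kap * block_norm_sq B i (block blk i z - block blk i u) + psi_val i u"
    using le \<open>gz = psi_val i T\<close> block_norm_sq_minus_commute[of B i T "block blk i u"]
      block_norm_sq_minus_commute[of B i "block blk i z" "block blk i u"] by simp
qed

lemma z_step_in_dom_psi:
  assumes "t > 0" "z \<in> dom_psi"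
  shows "z_step t A y z \<in> dom_psi"
  unfolding dom_psi_iff
proof
  fix i
  have fin: "psi i (argmin t y z i) \<noteq> \<infinity>"
    using argmin_three_point(1)[OF assms assms(2), of i y] by (metis PInfty_neq_ereal(1))
  have "psi i (block blk i (z_step t A y z)) \<noteq> \<infinity>"
    using fin assms(2) by (simp add: block_z_step[OF assms] dom_psi_iff)
  then show "psi i (block blk i (z_step t A y z)) = ereal (psi_val i (z_step t A y z))"
    using psi_not_minf[of i "z_step t A y z"]
    by (cases "psi i (block blk i (z_step t A y z))") (auto simp: psi_val_def)
qed

text \<open>
  The sampled displacement is \<open>h\<close> restricted to the sampled blocks, where \<open>h\<close> is the displacement for a
  step that updates all blocks. In the ESO inequality for \<open>h\<close>, the weights \<open>p\<^sub>i\<close> and \<open>v\<^sub>i p\<^sub>i\<close> meet the scaling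
  \<open>1 / p\<^sub>i\<close> of \<open>h\<close> and become \<open>1\<close> and \<open>v\<^sub>i / p\<^sub>i\<close>.
\<close>

lemma expected_smooth_decrease:
  fixes y z t
  defines "T \<equiv> argmin t y z"
  assumes "t > 0" and z: "z \<in> dom_psi"
  shows "measure_pmf.expectation Shat (\<lambda>A.
      f (y + t *\<^sub>R scale_blocks blk (\<chi> i. inverse (p $ i)) (z_step t A y z - z)))
    \<le> f y + (\<Sum>i\<in>UNIV. t * (block blk i (grad f y) \<bullet> (T i - block blk i z))
        + t\<^sup>2 / 2 * (v $ i / p $ i * block_norm_sq B i (T i - block blk i z)))"
proof -
  define h where "h = t *\<^sub>R scale_blocks blk (\<chi> i. inverse (p $ i)) ((\<Sum>i\<in>UNIV. T i) - z)"
  have block_h: "block blk i h = (t * inverse (p $ i)) *\<^sub>R (T i - block blk i z)" for i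
    unfolding h_def T_def
    by (simp add: linear_scale[OF linear_block] linear_diff[OF linear_block] block_scale_blocks
        block_sum_of_blocks argmin_in_block_space[OF \<open>t > 0\<close> z])
  have "t *\<^sub>R scale_blocks blk (\<chi> i. inverse (p $ i)) (z_step t A y z - z) = restrict_blocks blk A h" for A
    by (rule block_eqI[of blk])
      (simp add: block_linear_simps block_scale_blocks block_restrict_blocks block_h
        block_z_step[OF \<open>t > 0\<close> z] T_def)
  then have "measure_pmf.expectation Shat (\<lambda>A.
      f (y + t *\<^sub>R scale_blocks blk (\<chi> i. inverse (p $ i)) (z_step t A y z - z)))
    \<le> f y + winner blk p (grad f y) h + wnorm_sq blk B (\<chi> i. v $ i * p $ i) h / 2"
    using eso by (simp add: ESO_def p)
  also have "winner blk p (grad f y) h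
      = (\<Sum>i\<in>UNIV. t * (block blk i (grad f y) \<bullet> (T i - block blk i z)))"
    unfolding winner_def using p_pos less_imp_neq[OF p_pos, THEN not_sym]
    by (intro sum.cong) (simp_all add: block_h)
  also have "wnorm_sq blk B (\<chi> i. v $ i * p $ i) h
      = (\<Sum>i\<in>UNIV. t\<^sup>2 * (v $ i / p $ i * block_norm_sq B i (T i - block blk i z)))"
  proof -
    have "v $ i * p $ i * ((t * inverse (p $ i))\<^sup>2 * n) = t\<^sup>2 * (v $ i / p $ i * n)" for i n
      using p_pos[of i] by (simp add: power2_eq_square field_simps)
    then show ?thesis
      by (simp add: wnorm_sq_def block_h block_norm_sq_scale)
  qed
  finally show ?thesis
    by (simp add: sum.distrib sum_divide_distrib mult.commute[of 2])
qed

text \<open>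
  This is the convex combination, with weights \<open>1 - t\<close> and \<open>t\<close>, of the gradient inequalities at \<open>y\<close>
  towards \<open>x\<close> and towards \<open>u\<close>: by the choice of \<open>y\<close>, the directions combine to \<open>t * (u - z)\<close>.
\<close>

lemma linearized_f_at_combination_le:
  fixes x z u :: "real ^ 'm" and t :: real
  assumes t: "0 < t" "t \<le> 1"
  defines "y \<equiv> (1 - t) *\<^sub>R x + t *\<^sub>R z"
  shows "f y + t * (grad f y \<bullet> (u - z)) \<le> (1 - t) * f x + t * f u"
proof -
  have "(1 - t) * (f y + grad f y \<bullet> (x - y)) \<le> (1 - t) * f x"
    "t * (f y + grad f y \<bullet> (u - y)) \<le> t * f u"
    using t convex_above_gradient_plane[OF f_convex f_diff] by (simp_all add: mult_left_mono)
  moreover have "(1 - t) * (grad f y \<bullet> (x - y)) + t * (grad f y \<bullet> (u - y)) = t * (grad f y \<bullet> (u - z))"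
  proof -
    have "(1 - t) *\<^sub>R (x - y) + t *\<^sub>R (u - y) = t *\<^sub>R (u - z)"
      by (simp add: y_def algebra_simps)
    then show ?thesis
      by (metis inner_add_right inner_scaleR_right)
  qed
  ultimately show ?thesis
    by (simp add: algebra_simps)
qed

text \<open>
  Here \<open>s i\<close> stands for the current upper bound on \<open>\<psi>\<^sup>i(x\<^sup>i)\<close>, and the summand with \<open>s i\<close> on the left is its
  update by the recursion of \<open>lagged\<close>. Only the blocks of \<open>A\<close> change, so the expectations of the
  separable terms reduce to the probabilities \<open>p\<^sub>i\<close>; the smooth term is bounded by the ESO inequality.
  What remains is a sum over blocks in which the three-point inequality applies to each summand.
\<close>

lemma expected_one_step:
  fixes x z u :: "real ^ 'm" and t :: real and s :: "'n \<Rightarrow> real"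
  assumes t: "0 < t" "t \<le> 1" and z: "z \<in> dom_psi" and u: "u \<in> dom_psi"
  defines "y \<equiv> (1 - t) *\<^sub>R x + t *\<^sub>R z"
  shows "measure_pmf.expectation Shat (\<lambda>A.
      f (y + t *\<^sub>R scale_blocks blk (\<chi> i. inverse (p $ i)) (z_step t A y z - z))
      + (\<Sum>i\<in>UNIV. (1 - t) * s i + t * psi_val i z + t / p $ i * (psi_val i (z_step t A y z) - psi_val i z))
      + t\<^sup>2 / 2 * dist_sq (z_step t A y z) u)
    \<le> (1 - t) * (f x + (\<Sum>i\<in>UNIV. s i)) + t * (f u + (\<Sum>i\<in>UNIV. psi_val i u))
      + t\<^sup>2 / 2 * dist_sq z u"
    (is "measure_pmf.expectation _ (\<lambda>A. ?f A + (\<Sum>i\<in>UNIV. ?s A i) + t\<^sup>2 / 2 * ?d A) \<le> _")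
proof -
  note step = block_z_step[OF t(1) z]
  define T where "T = argmin t y z"
  define N where "N i a = block_norm_sq B i (a - block blk i u)" for i a
  note int = integrable_measure_pmf_finite[OF finite]
  have T: "block blk i (T i) = T i" for i
    using argmin_in_block_space[OF t(1) z] by (simp add: T_def block_ident)
  have pn: "p $ i \<noteq> 0" for i
    using p_pos[of i] by simp
  have E_s: "measure_pmf.expectation Shat (\<lambda>A. ?s A i) = (1 - t) * s i + t * psi_val i (T i)" for i
  proof -
    have "?s A i = (if i \<in> A then (1 - t) * s i + t * psi_val i z + t / p $ i * (psi_val i (T i) - psi_val i z)
        else (1 - t) * s i + t * psi_val i z)" for A
      using T by (simp add: psi_val_def step T_def)
    then show ?thesis
      using pn[of i] by (simp only: expectation_by_membership flip: p) (simp add: field_simps)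
  qed
  have E_d: "measure_pmf.expectation Shat ?d
      = (\<Sum>i\<in>UNIV. v $ i * inverse (p $ i) ^ 2 * N i (block blk i z)
          + v $ i / p $ i * (N i (T i) - N i (block blk i z)))"
  proof -
    have "?d A = (\<Sum>i\<in>UNIV. if i \<in> A then v $ i * inverse (p $ i) ^ 2 * N i (T i)
        else v $ i * inverse (p $ i) ^ 2 * N i (block blk i z))" for A
      unfolding wnorm_sq_def by (intro sum.cong) (auto simp: block_linear_simps step T_def N_def)
    then have "measure_pmf.expectation Shat ?d
        = (\<Sum>i\<in>UNIV. v $ i * inverse (p $ i) ^ 2 * N i (block blk i z)
            + p $ i * (v $ i * inverse (p $ i) ^ 2 * N i (T i)
              - v $ i * inverse (p $ i) ^ 2 * N i (block blk i z)))"
      by (simp add: Bochner_Integration.integral_sum int expectation_by_membership p)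
    also have "\<dots> = (\<Sum>i\<in>UNIV. v $ i * inverse (p $ i) ^ 2 * N i (block blk i z)
          + v $ i / p $ i * (N i (T i) - N i (block blk i z)))"
      using pn by (intro sum.cong) (simp_all add: power2_eq_square field_simps)
    finally show ?thesis .
  qed
  have "measure_pmf.expectation Shat (\<lambda>A. ?f A + (\<Sum>i\<in>UNIV. ?s A i) + t\<^sup>2 / 2 * ?d A)
      = measure_pmf.expectation Shat ?f + (\<Sum>i\<in>UNIV. measure_pmf.expectation Shat (\<lambda>A. ?s A i))
        + t\<^sup>2 / 2 * measure_pmf.expectation Shat ?d"
    by (simp only: Bochner_Integration.integral_add Bochner_Integration.integral_sum
        integral_mult_right_zero int)
  also have "\<dots> \<le> f y + (\<Sum>i\<in>UNIV. t * (block blk i (grad f y) \<bullet> (T i - block blk i z))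
        + t\<^sup>2 / 2 * (v $ i / p $ i * block_norm_sq B i (T i - block blk i z)))
      + (\<Sum>i\<in>UNIV. (1 - t) * s i + t * psi_val i (T i))
      + t\<^sup>2 / 2 * (\<Sum>i\<in>UNIV. v $ i * inverse (p $ i) ^ 2 * N i (block blk i z)
          + v $ i / p $ i * (N i (T i) - N i (block blk i z)))"
    unfolding E_s E_d T_def using expected_smooth_decrease[OF t(1) z, of y]
    by (intro add_mono order_refl)
  also have "\<dots> = f y + (1 - t) * (\<Sum>i\<in>UNIV. s i)
      + t\<^sup>2 / 2 * (\<Sum>i\<in>UNIV. v $ i * inverse (p $ i) ^ 2 * N i (block blk i z))
      + (\<Sum>i\<in>UNIV. t * (block blk i (grad f y) \<bullet> (T i - block blk i z))
          + t\<^sup>2 / 2 * (v $ i / p $ i * block_norm_sq B i (T i - block blk i z))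
          + t * psi_val i (T i) + t\<^sup>2 / 2 * (v $ i / p $ i * (N i (T i) - N i (block blk i z))))"
    by (simp only: sum.distrib flip: sum_distrib_left) (simp add: algebra_simps)
  also have "\<dots> \<le> f y + (1 - t) * (\<Sum>i\<in>UNIV. s i)
      + t\<^sup>2 / 2 * (\<Sum>i\<in>UNIV. v $ i * inverse (p $ i) ^ 2 * N i (block blk i z))
      + (\<Sum>i\<in>UNIV. t * (block blk i (grad f y) \<bullet> block blk i (u - z)) + t * psi_val i u)"
  proof (intro add_left_mono sum_mono)
    fix i
    define kap where "kap = t * v $ i / (2 * p $ i)"
    have kap: "t\<^sup>2 / 2 * (v $ i / p $ i * c) = t * (kap * c)" for c
      by (simp add: kap_def power2_eq_square)
    have "t * (block blk i (grad f y) \<bullet> T i + kap * block_norm_sq B i (T i - block blk i z)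
          + psi_val i (T i) + kap * N i (T i))
        \<le> t * (block blk i (grad f y) \<bullet> block blk i u + kap * N i (block blk i z) + psi_val i u)"
      using argmin_three_point(2)[OF t(1) z u, of i y] t(1)
      unfolding T_def N_def kap_def by (intro mult_left_mono) auto
    then show "t * (block blk i (grad f y) \<bullet> (T i - block blk i z))
          + t\<^sup>2 / 2 * (v $ i / p $ i * block_norm_sq B i (T i - block blk i z))
          + t * psi_val i (T i) + t\<^sup>2 / 2 * (v $ i / p $ i * (N i (T i) - N i (block blk i z)))
        \<le> t * (block blk i (grad f y) \<bullet> block blk i (u - z)) + t * psi_val i u"
      unfolding kap by (simp add: block_linear_simps inner_diff_right algebra_simps)
  qed
  also have "\<dots> = f y + t * (grad f y \<bullet> (u - z)) + (1 - t) * (\<Sum>i\<in>UNIV. s i)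
      + t * (\<Sum>i\<in>UNIV. psi_val i u) + t\<^sup>2 / 2 * dist_sq z u"
    by (simp add: sum.distrib sum_distrib_left wnorm_sq_def N_def block_linear_simps
        inner_eq_sum_blocks[of "grad f y" _ blk])
  also have "\<dots> \<le> (1 - t) * f x + t * f u + (1 - t) * (\<Sum>i\<in>UNIV. s i)
      + t * (\<Sum>i\<in>UNIV. psi_val i u) + t\<^sup>2 / 2 * dist_sq z u"
    using linearized_f_at_combination_le[OF t, of x z u] by (simp add: y_def)
  finally show ?thesis
    by (simp add: algebra_simps)
qed

end

section \<open>The random iterates and their potential\<close>

locale alpha_run = alpha_problem blk B f psi Shat p v + prob_space M
  for blk :: "'m::finite \<Rightarrow> 'n::finite"
    and B :: "'n \<Rightarrow> real ^ 'm ^ 'm"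
    and f :: "real ^ 'm \<Rightarrow> real"
    and psi :: "'n \<Rightarrow> real ^ 'm \<Rightarrow> ereal"
    and Shat :: "'n set pmf"
    and p v :: "real ^ 'n"
    and M :: "'w measure" +
  fixes theta :: "nat \<Rightarrow> real"
    and x0 :: "real ^ 'm"
    and S :: "nat \<Rightarrow> 'w \<Rightarrow> 'n set"
  assumes theta0: "0 < theta 0" "\<And>i. theta 0 \<le> p $ i"
    and theta_Suc: "\<And>j. theta (Suc j) = (sqrt (theta j ^ 4 + 4 * theta j ^ 2) - theta j ^ 2) / 2"
    and x0: "x0 \<in> dom_psi"
    and S_indep: "indep_vars (\<lambda>_. count_space UNIV) S UNIV"
    and S_distr: "\<And>j. distr M (count_space UNIV) (S j) = measure_pmf Shat"
begin

abbreviation iterates :: "(nat \<Rightarrow> 'n set) \<Rightarrow> nat \<Rightarrow> (real ^ 'm) \<times> (real ^ 'm)" where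
  "iterates s k \<equiv> alpha_xz blk B f psi p v theta x0 s k"

abbreviation X :: "(nat \<Rightarrow> 'n set) \<Rightarrow> nat \<Rightarrow> real ^ 'm" where
  "X s k \<equiv> alpha_x blk B f psi p v theta x0 s k"

definition Z :: "(nat \<Rightarrow> 'n set) \<Rightarrow> nat \<Rightarrow> real ^ 'm" where
  "Z s k = snd (iterates s k)"

definition Y :: "(nat \<Rightarrow> 'n set) \<Rightarrow> nat \<Rightarrow> real ^ 'm" where
  "Y s k = (1 - theta k) *\<^sub>R X s k + theta k *\<^sub>R Z s k"

text \<open>
  The surrogate for \<open>\<psi>\<^sup>i(x\<^sub>k\<^sup>i)\<close>: the average that produces block \<open>i\<close> of \<open>x\<^sub>k\<close> from the \<open>z\<^sub>j\<^sup>i\<close>, applied to the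
  values of \<open>\<psi>\<^sup>i\<close>. It evolves affinely under sampling, which \<open>\<psi>\<^sup>i(x\<^sub>k\<^sup>i)\<close> does not.
\<close>

definition psi_hat :: "(nat \<Rightarrow> 'n set) \<Rightarrow> nat \<Rightarrow> 'n \<Rightarrow> real" where
  "psi_hat s k i = lagged theta (p $ i) (\<lambda>j. psi_val i (Z s j)) k"

definition F_hat :: "(nat \<Rightarrow> 'n set) \<Rightarrow> nat \<Rightarrow> real" where
  "F_hat s k = f (X s k) + (\<Sum>i\<in>UNIV. psi_hat s k i)"

definition F_val :: "real ^ 'm \<Rightarrow> real" where
  "F_val u = f u + (\<Sum>i\<in>UNIV. psi_val i u)"

definition potential :: "real ^ 'm \<Rightarrow> (nat \<Rightarrow> 'n set) \<Rightarrow> nat \<Rightarrow> real" where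
  "potential u s k = (1 - theta k) / theta k ^ 2 * (F_hat s k - F_val u) + dist_sq (Z s k) u / 2"

lemma theta0_le_1: "theta 0 \<le> 1"
  using theta0(2) p_le_1 by (rule order_trans)

lemmas theta_bounds = theta_recursion_bounds[OF theta0(1) theta0_le_1 theta_Suc]

lemma X_0: "X s 0 = x0" and Z_0: "Z s 0 = x0"
  by (simp_all add: alpha_x_def Z_def)

lemma Z_Suc: "Z s (Suc k) = z_step (theta k) (s k) (Y s k) (Z s k)"
  by (simp add: Z_def Y_def alpha_x_def split_beta Let_def)

lemma X_Suc: "X s (Suc k)
    = Y s k + theta k *\<^sub>R scale_blocks blk (\<chi> i. inverse (p $ i)) (Z s (Suc k) - Z s k)"
  by (simp add: Z_def Y_def alpha_x_def split_beta Let_def)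

lemma Z_in_dom_psi: "Z s k \<in> dom_psi"
  by (induction k) (simp_all add: Z_0 x0 Z_Suc z_step_in_dom_psi theta_bounds(1))

lemma block_X: "block blk i (X s k) = lagged theta (p $ i) (\<lambda>j. block blk i (Z s j)) k"
  by (induction k)
    (simp_all add: X_0 Z_0 X_Suc Y_def block_linear_simps block_scale_blocks divide_inverse)

text \<open>
  The pairs \<open>(z\<^sub>j\<^sup>i, \<psi>\<^sup>i(z\<^sub>j\<^sup>i))\<close> lie in the convex epigraph of \<open>\<psi>\<^sup>i\<close>, hence so does their lagged average
  \<open>(x\<^sub>k\<^sup>i, psi_hat)\<close>. In particular the iterates stay in the domain of \<open>\<psi>\<close>, even though the update of
  \<open>x\<close> extrapolates.
\<close>

lemma psi_le_psi_hat: "psi i (block blk i (X s k)) \<le> ereal (psi_hat s k i)"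
proof -
  let ?E = "epigraph_on (block_space blk i) (psi i)"
  have "lagged theta (p $ i) (\<lambda>j. (block blk i (Z s j), psi_val i (Z s j))) k \<in> ?E"
  proof (rule lagged_in_convex)
    show "convex ?E"
      using psi[of i] by (simp add: closed_convex_on_def)
    show "(block blk i (Z s j), psi_val i (Z s j)) \<in> ?E" for j
      using Z_in_dom_psi[of s j] by (simp add: epigraph_on_def dom_psi_iff)
  qed (use theta_bounds theta0(2) p_le_1 in auto)
  then show ?thesis
    by (simp add: lagged_Pair epigraph_on_def psi_hat_def block_X)
qed

lemma X_in_dom_psi: "X s k \<in> dom_psi"
proof -
  have "psi i (block blk i (X s k)) = ereal (psi_val i (X s k))" for i
    using psi_le_psi_hat[of i s k] psi_not_minf[of i "X s k"]
    by (cases "psi i (block blk i (X s k))") (auto simp: psi_val_def)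
  then show ?thesis
    by (simp add: dom_psi_iff)
qed

lemma F_val_le_F_hat: "F_val (X s k) \<le> F_hat s k"
proof -
  have "psi_val i (X s k) \<le> psi_hat s k i" for i
    using psi_le_psi_hat[of i s k] X_in_dom_psi[of s k] by (simp add: dom_psi_iff)
  then show ?thesis
    by (simp add: F_val_def F_hat_def sum_mono)
qed

lemma iterates_cong: "(\<And>j. j < k \<Longrightarrow> s j = s' j) \<Longrightarrow> iterates s k = iterates s' k"
  by (induction k) (simp_all add: Let_def)

text \<open>
  After \<open>k\<close> iterations only the first \<open>k\<close> sampled sets have been used; this is what makes the next one
  independent of the current state.
\<close>

lemma state_cong:
  assumes "\<And>j. j < k \<Longrightarrow> s j = s' j"
  shows "X s k = X s' k" "Z s k = Z s' k" "Y s k = Y s' k" "psi_hat s k i = psi_hat s' k i"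
    "F_hat s k = F_hat s' k" "potential u s k = potential u s' k"
proof -
  have eq: "X s j = X s' j" "Z s j = Z s' j" if "j \<le> k" for j
    using iterates_cong[of j s s'] that assms by (simp_all add: alpha_x_def Z_def)
  then show "X s k = X s' k" "Z s k = Z s' k"
    by simp_all
  then show "Y s k = Y s' k"
    by (simp add: Y_def)
  have psi_hat: "psi_hat s k i = psi_hat s' k i" for i
    unfolding psi_hat_def by (rule lagged_cong) (simp add: eq)
  then show "psi_hat s k i = psi_hat s' k i" .
  show F_hat: "F_hat s k = F_hat s' k"
    using eq[of k] by (simp add: F_hat_def psi_hat)
  show "potential u s k = potential u s' k"
    using eq[of k] by (simp add: potential_def F_hat)
qed

lemma integrable_of_history:
  fixes G :: "(nat \<Rightarrow> 'n set) \<Rightarrow> real"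
  assumes "\<And>s s'. (\<And>j. j < k \<Longrightarrow> s j = s' j) \<Longrightarrow> G s = G s'"
  shows "integrable M (\<lambda>w. G (\<lambda>j. S j w))"
proof (rule integrable_finite_history)
  show "random_variable (count_space UNIV) (S j)" for j
    using S_indep by (simp add: indep_vars_def)
qed (rule assms)

text \<open>
  This is \<open>expected_one_step\<close> divided by \<open>\<theta>\<^sub>k\<^sup>2\<close>: the coefficient of the gap in the next potential is
  \<open>1 / \<theta>\<^sub>k\<^sup>2\<close> by the recursion for \<open>\<theta>\<close>.
\<close>

lemma potential_Suc_le:
  assumes u: "u \<in> dom_psi"
  shows "measure_pmf.expectation Shat (\<lambda>A. potential u (s(k := A)) (Suc k)) \<le> potential u s k"
proof -
  let ?t = "theta k"
  note t = theta_bounds(1,2)[of k]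
  let ?z = "\<lambda>A. z_step ?t A (Y s k) (Z s k)"
  define surrogate where "surrogate A =
      f (Y s k + ?t *\<^sub>R scale_blocks blk (\<chi> i. inverse (p $ i)) (?z A - Z s k))
      + (\<Sum>i\<in>UNIV. (1 - ?t) * psi_hat s k i + ?t * psi_val i (Z s k)
          + ?t / p $ i * (psi_val i (?z A) - psi_val i (Z s k)))
      + ?t\<^sup>2 / 2 * dist_sq (?z A) u" for A
  have same: "X (s(k := A)) k = X s k" "Z (s(k := A)) k = Z s k" "Y (s(k := A)) k = Y s k"
    "psi_hat (s(k := A)) k i = psi_hat s k i" for A i
    by (rule state_cong; simp)+
  have Z': "Z (s(k := A)) (Suc k) = ?z A" for A
    by (simp add: Z_Suc same)
  have F': "F_hat (s(k := A)) (Suc k) + ?t\<^sup>2 / 2 * dist_sq (?z A) u = surrogate A" for A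
  proof -
    have "psi_hat (s(k := A)) (Suc k) i = (1 - ?t) * psi_hat s k i + ?t * psi_val i (Z s k)
          + ?t / p $ i * (psi_val i (?z A) - psi_val i (Z s k))" for i
      using same(4)[of A i] by (simp add: psi_hat_def Z' same(2))
    then show ?thesis
      by (simp add: F_hat_def surrogate_def X_Suc same Z')
  qed
  have pot: "potential u (s(k := A)) (Suc k) = (surrogate A - F_val u) / ?t\<^sup>2" for A
  proof -
    have "potential u (s(k := A)) (Suc k)
        = (F_hat (s(k := A)) (Suc k) - F_val u) / ?t\<^sup>2 + dist_sq (?z A) u / 2"
      using theta_bounds(4)[of k] by (simp add: potential_def Z')
    then show ?thesis
      using t(1) by (simp add: field_simps flip: F')
  qed
  have "measure_pmf.expectation Shat (\<lambda>A. potential u (s(k := A)) (Suc k))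
      = (measure_pmf.expectation Shat surrogate - F_val u) / ?t\<^sup>2"
    unfolding pot by (simp add: integrable_measure_pmf_finite)
  also have "\<dots> \<le> ((1 - ?t) * F_hat s k + ?t * F_val u + ?t\<^sup>2 / 2 * dist_sq (Z s k) u - F_val u) / ?t\<^sup>2"
    using expected_one_step[OF t Z_in_dom_psi[of s k] u, of "X s k" "psi_hat s k"]
    unfolding surrogate_def F_hat_def F_val_def Y_def
    by (intro divide_right_mono diff_right_mono) (auto simp: algebra_simps)
  also have "\<dots> = potential u s k"
    using t(1) by (simp add: potential_def field_simps)
  finally show ?thesis .
qed

lemma expected_potential_le:
  assumes u: "u \<in> dom_psi"
  shows "expectation (\<lambda>w. potential u (\<lambda>j. S j w) k)
    \<le> (1 - theta 0) / theta 0 ^ 2 * (F_val x0 - F_val u) + dist_sq x0 u / 2"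
proof (induction k)
  case 0
  have "potential u s 0 = (1 - theta 0) / theta 0 ^ 2 * (F_val x0 - F_val u) + dist_sq x0 u / 2" for s
    by (simp add: potential_def F_hat_def F_val_def psi_hat_def X_0 Z_0)
  then show ?case
    by (simp add: prob_space)
next
  case (Suc k)
  have "expectation (\<lambda>w. potential u (\<lambda>j. S j w) (Suc k))
      = expectation (\<lambda>w. measure_pmf.expectation Shat (\<lambda>A. potential u ((\<lambda>j. S j w)(k := A)) (Suc k)))"
    by (rule expectation_next_given_history[OF S_indep S_distr]) (rule state_cong)
  also have "\<dots> \<le> expectation (\<lambda>w. potential u (\<lambda>j. S j w) k)"
  proof (rule integral_mono)
    show "integrable M (\<lambda>w. measure_pmf.expectation Shat (\<lambda>A. potential u ((\<lambda>j. S j w)(k := A)) (Suc k)))"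
    proof (rule integrable_of_history[where k = k and
          G = "\<lambda>s. measure_pmf.expectation Shat (\<lambda>A. potential u (s(k := A)) (Suc k))"])
      fix s s' :: "nat \<Rightarrow> 'n set"
      assume "\<And>j. j < k \<Longrightarrow> s j = s' j"
      then have "potential u (s(k := A)) (Suc k) = potential u (s'(k := A)) (Suc k)" for A
        by (intro state_cong) (auto simp: less_Suc_eq)
      then show "measure_pmf.expectation Shat (\<lambda>A. potential u (s(k := A)) (Suc k))
          = measure_pmf.expectation Shat (\<lambda>A. potential u (s'(k := A)) (Suc k))"
        by simp
    qed
    show "integrable M (\<lambda>w. potential u (\<lambda>j. S j w) k)"
      by (rule integrable_of_history[where k = k and G = "\<lambda>s. potential u s k"]) (rule state_cong)
    show "measure_pmf.expectation Shat (\<lambda>A. potential u ((\<lambda>j. S j w)(k := A)) (Suc k))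
        \<le> potential u (\<lambda>j. S j w) k" for w
      by (rule potential_Suc_le[OF u])
  qed
  finally show ?case
    using Suc by linarith
qed

lemma integrable_F_val_X: "integrable M (\<lambda>w. F_val (X (\<lambda>j. S j w) k))"
  by (rule integrable_of_history[where k = k and G = "\<lambda>s. F_val (X s k)"])
    (metis state_cong(1))

text \<open>
  After \<open>Suc k\<close> iterations the gap enters the potential with the coefficient \<open>1 / \<theta>\<^sub>k\<^sup>2\<close>. Dropping the
  distance term leaves \<open>C * (\<theta>\<^sub>k / \<theta>\<^sub>0)\<^sup>2\<close> as a bound; nonnegativity of \<open>C\<close> is needed to insert the upper
  bound on \<open>\<theta>\<^sub>k\<close>.
\<close>

lemma expected_gap_le:
  assumes u: "u \<in> dom_psi"
  defines "C \<equiv> (1 - theta 0) * (F_val x0 - F_val u) + theta 0 ^ 2 / 2 * dist_sq x0 u"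
  assumes C: "C \<ge> 0"
  shows "expectation (\<lambda>w. F_val (X (\<lambda>j. S j w) (Suc k))) - F_val u
    \<le> 4 * C / (real k * theta 0 + 2) ^ 2"
proof -
  have t: "theta j > 0" for j
    by (rule theta_bounds)
  have "(expectation (\<lambda>w. F_val (X (\<lambda>j. S j w) (Suc k))) - F_val u) / theta k ^ 2
      = expectation (\<lambda>w. (F_val (X (\<lambda>j. S j w) (Suc k)) - F_val u) / theta k ^ 2)"
    using integrable_F_val_X[of "Suc k"] by (simp add: prob_space)
  also have "\<dots> \<le> expectation (\<lambda>w. potential u (\<lambda>j. S j w) (Suc k))"
  proof (rule integral_mono)
    show "integrable M (\<lambda>w. (F_val (X (\<lambda>j. S j w) (Suc k)) - F_val u) / theta k ^ 2)"
      using integrable_F_val_X[of "Suc k"] by simp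
    show "integrable M (\<lambda>w. potential u (\<lambda>j. S j w) (Suc k))"
      by (rule integrable_of_history[where k = "Suc k" and G = "\<lambda>s. potential u s (Suc k)"])
        (rule state_cong)
    show "(F_val (X (\<lambda>j. S j w) (Suc k)) - F_val u) / theta k ^ 2 \<le> potential u (\<lambda>j. S j w) (Suc k)" for w
    proof -
      have "(F_val (X (\<lambda>j. S j w) (Suc k)) - F_val u) / theta k ^ 2
          \<le> (F_hat (\<lambda>j. S j w) (Suc k) - F_val u) / theta k ^ 2"
        using F_val_le_F_hat by (intro divide_right_mono) auto
      then show ?thesis
        using dist_sq_nonneg[of "Z (\<lambda>j. S j w) (Suc k)" u] theta_bounds(4)[of k]
        by (simp add: potential_def)
    qed
  qed
  also have "\<dots> \<le> C / theta 0 ^ 2"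
    using expected_potential_le[OF u, of "Suc k"] t[of 0] by (simp add: C_def add_divide_distrib)
  finally have "expectation (\<lambda>w. F_val (X (\<lambda>j. S j w) (Suc k))) - F_val u
      \<le> C * (theta k / theta 0) ^ 2"
    using t[of k] by (simp add: field_simps power_divide)
  also have "\<dots> \<le> C * (2 / (real k * theta 0 + 2)) ^ 2"
    using C theta_bounds(5)[of k] t by (intro mult_left_mono power_mono) (auto simp: less_imp_le)
  finally show ?thesis
    by (simp add: power_divide mult.commute)
qed

end

section \<open>Convergence rate\<close>

theorem theorem4:
  fixes blk :: "'m::finite \<Rightarrow> 'n::finite"
    and B :: "'n \<Rightarrow> real ^ 'm ^ 'm"
    and f :: "real ^ 'm \<Rightarrow> real"
    and psi :: "'n \<Rightarrow> real ^ 'm \<Rightarrow> ereal"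
    and F :: "real ^ 'm \<Rightarrow> ereal"
    and Shat :: "'n set pmf"
    and p v :: "real ^ 'n"
    and theta :: "nat \<Rightarrow> real"
    and x0 y :: "real ^ 'm"
    and M :: "'w measure"
    and S :: "nat \<Rightarrow> 'w \<Rightarrow> 'n set"
    and C :: ereal
    and k :: nat
  assumes B: "\<And>i. block_pos_def blk i (B i)"
    and f_convex: "convex_on UNIV f"
    and f_diff: "\<And>x. f differentiable (at x)"
    and psi: "\<And>i. closed_convex_on (block_space blk i) (psi i)"
    and F: "F = (\<lambda>x. ereal (f x) + block_sum blk psi x)"
    and proper: "proper_sampling Shat"
    and p: "p = sampling_prob Shat"
    and v_pos: "\<And>i. v $ i > 0"
    and eso: "ESO blk B f Shat v"
    and theta0: "0 < theta 0" "theta 0 \<le> (MIN i. p $ i)"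
    and theta_Suc: "\<And>j. theta (Suc j) = (sqrt (theta j ^ 4 + 4 * theta j ^ 2) - theta j ^ 2) / 2"
    and x0: "x0 \<in> edom (block_sum blk psi)"
    and M: "prob_space M"
    and S_indep: "prob_space.indep_vars M (\<lambda>_. count_space UNIV) S UNIV"
    and S_distr: "\<And>j. distr M (count_space UNIV) (S j) = measure_pmf Shat"
    and C: "C = ereal (1 - theta 0) * (F x0 - F y)
              + ereal (theta 0 ^ 2 / 2 * wnorm_sq blk B (\<chi> i. v $ i * inverse (p $ i) ^ 2) (x0 - y))"
    and C_nonneg: "C \<ge> 0"
    and k: "k \<ge> 1"
  shows "ereal_expectation M (\<lambda>w. F (alpha_x blk B f psi p v theta x0 (\<lambda>j. S j w) k)) - F y
           \<le> 4 * C / ereal (((real k - 1) * theta 0 + 2) ^ 2)"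
proof -
  interpret prob_space M
    by (rule M)
  have "theta 0 \<le> p $ i" for i
    using theta0(2) by (rule order_trans) (rule Min_le, auto)
  then interpret alpha_run blk B f psi Shat p v M theta x0 S
    using assms by unfold_locales auto
  obtain j where j: "k = Suc j"
    using k by (cases k) auto
  have den: "((real k - 1) * theta 0 + 2) ^ 2 = (real j * theta 0 + 2) ^ 2"
    "(real j * theta 0 + 2) ^ 2 > 0"
    using theta0(1) by (simp add: j) (intro zero_less_power add_nonneg_pos, use theta0(1) in auto)
  have F_dom: "F x = ereal (F_val x)" if "x \<in> dom_psi" for x
    by (simp add: F block_sum_eq[OF that] F_val_def)
  have E: "ereal_expectation M (\<lambda>w. F (X (\<lambda>j. S j w) k)) = ereal (expectation (\<lambda>w. F_val (X (\<lambda>j. S j w) k)))"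
    by (simp only: F_dom X_in_dom_psi ereal_expectation_real[OF integrable_F_val_X])
  show ?thesis
  proof (cases "y \<in> dom_psi")
    case True
    have C': "C = ereal ((1 - theta 0) * (F_val x0 - F_val y) + theta 0 ^ 2 / 2 * dist_sq x0 y)"
      unfolding C by (simp add: F_dom x0 True)
    then show ?thesis
      using expected_gap_le[OF True, of j] C_nonneg den
      unfolding E by (simp add: F_dom True j)
  next
    case False
    \<comment> \<open>The expectation is finite, so subtracting \<open>F y = \<infinity>\<close> leaves \<open>- \<infinity>\<close> on the left.\<close>
    then have "F y = \<infinity>"
      by (simp add: F edom_def)
    then show ?thesis
      unfolding E by simp
  qed
qed

end
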